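(* Assume (A3), (A4), let $q\in(0,1)$, $p\in(0,2]$ with $p<q+1$, and let $x$ be a trajectory solution of (MTRIGS) with initial data $(x_0,v_0)$. Then for every $r\in[q,1)\cap[p-q,1)$, as $t\to+\infty$: (i) $\mathcal E^r_\lambda(t)=O(t^{3r-(p+1)})$ for every $\lambda\in(0,\frac{2\alpha}3]\cap(0,\frac\beta\alpha]$; (ii) $\varphi_t(x(t))=O(t^{r-(p+1)})$; (iii) $\varphi(x(t))=O(t^{-p})$; (iv) $\|x(t)-z(t)\|=O(t^{\frac{r-1}{2}})$; (v) $\|\dot x(t)\|=O(t^{\frac{r-(p+1)}{2}})$.
   Context: $\mathcal H$ real Hilbert space; $f_1,\dots,f_m:\mathcal H\to\mathbb R$ convex, continuously differentiable with Lipschitz continuous gradients; $F=(f_1,\dots,f_m)^\top$. Weak Pareto optimal: no $x$ with $f_i(x)<f_i(x^* )$ for all $i$; $\mathcal P_w$ the set of such points. $\mathcal L(F,b):=\{x:f_i(x)\le b_i\ \forall i\}$, $\mathcal{LP}_w(F,b):=\mathcal L(F,b)\cap\mathcal P_w$. Merit function $\varphi(x):=\sup_z\min_i(f_i(x)-f_i(z))$. Parameters $t_0>0$, $\alpha,\beta>0$, $q\in(0,1]$, $p\in(0,2]$, initial data $x_0,v_0\in\mathcal H$; $C(x):=\operatorname{conv}\{\nabla f_i(x)\}$. A trajectory solution of (MTRIGS) is $x:[t_0,\infty)\to\mathcal H$, continuously differentiable, with $\dot x$ absolutely continuous on each $[t_0,T]$ and a.e. derivative $\ddot x$ (Bochner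 measurable, $\dot x(t)=\dot x(t_0)+\int_{t_0}^t\ddot x$), satisfying $\frac{\alpha}{t^q}\dot x(t)+\operatorname{proj}_{C(x(t))+\frac{\beta}{t^p}x(t)+\ddot x(t)}(0)=0$ for a.e. $t\ge t_0$, $x(t_0)=x_0$, $\dot x(t_0)=v_0$. (A3): with $a_i:=\frac{\beta}{2t_0^p}\|x_0\|^2+\frac12\|v_0\|^2$, for every $x\in\mathcal L(F,F(x_0)+a)$, $\mathcal{LP}_w(F,F(x))\ne\emptyset$, and $R:=\sup_{F^*\in F(\mathcal{LP}_w(F,F(x_0)+a))}\inf_{z\in F^{-1}(\{F^*\})}\|z\|<\infty$. (A4): $S(w):=\operatorname{argmin}_z\max_i(f_i(z)-w_i)\neq\emptyset$ for all $w\in\mathbb R^m$ and $w\mapsto\operatorname{proj}_{S(w)}(0)$ is continuous. $f_{t,i}(x):=f_i(x)+\frac{\beta}{2t^p}\|x\|^2$; $\varphi_t(x):=\sup_z\min_i(f_{t,i}(x)-f_{t,i}(z))$; $z(t):=\operatorname{argmin}_z\max_i(f_{t,i}(z)-f_{t,i}(x(t)))$. For $r\in[q,1]$ and $\lambda>0$: $\mathcal E^r_\lambda(t):=t^{2r}\varphi_t(x(t))+\frac12\|\lambda(x(t)-z(t))+t^r\dot x(t)\|^2+\frac\lambda2\big(rt^{r-1}+\alpha t^{r-q}-2\lambda\big)\|x(t)-z(t)\|^2$. *)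

theory Defs
  imports "HOL-Analysis.Analysis" "HOL-Library.Landau_Symbols"
begin

text \<open>Objectives are indexed by a finite type 'm (m = CARD('m) >= 1);
  vectors in R^m are functions 'm => real. The Hilbert space is a type
  of class real_inner + complete_space.\<close>

definition weak_pareto :: "('m::finite \<Rightarrow> 'a \<Rightarrow> real) \<Rightarrow> 'a set" where
  "weak_pareto f = {xs. \<not> (\<exists>x. \<forall>i. f i x < f i xs)}"

definition level_set :: "('m::finite \<Rightarrow> 'a \<Rightarrow> real) \<Rightarrow> ('m \<Rightarrow> real) \<Rightarrow> 'a set" where
  "level_set f b = {x. \<forall>i. f i x \<le> b i}"

definition LPw :: "('m::finite \<Rightarrow> 'a \<Rightarrow> real) \<Rightarrow> ('m \<Rightarrow> real) \<Rightarrow> 'a set" where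
  "LPw f b = level_set f b \<inter> weak_pareto f"

definition merit :: "('m::finite \<Rightarrow> 'a \<Rightarrow> real) \<Rightarrow> 'a \<Rightarrow> ereal" where
  "merit f x = (SUP z. ereal (Min (range (\<lambda>i. f i x - f i z))))"

definition proj :: "'a::real_normed_vector set \<Rightarrow> 'a \<Rightarrow> 'a" where
  "proj S y = (THE z. z \<in> S \<and> (\<forall>w\<in>S. dist y z \<le> dist y w))"

definition argmin_set :: "('a \<Rightarrow> real) \<Rightarrow> 'a set" where
  "argmin_set h = {z. \<forall>w. h z \<le> h w}"

definition abs_cont_on :: "real set \<Rightarrow> (real \<Rightarrow> 'a::real_normed_vector) \<Rightarrow> bool" where
  "abs_cont_on S v \<longleftrightarrow>
    (\<forall>\<epsilon>>0. \<exists>\<delta>>0. \<forall>(n::nat) (a::nat \<Rightarrow> real) b.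
       (\<forall>k<n. a k \<le> b k \<and> {a k..b k} \<subseteq> S) \<and>
       (\<forall>j<n. \<forall>k<n. j \<noteq> k \<longrightarrow> b j \<le> a k \<or> b k \<le> a j) \<and>
       (\<Sum>k<n. b k - a k) < \<delta> \<longrightarrow>
       (\<Sum>k<n. norm (v (b k) - v (a k))) < \<epsilon>)"

definition freg :: "real \<Rightarrow> real \<Rightarrow> ('m \<Rightarrow> 'a \<Rightarrow> real) \<Rightarrow> real \<Rightarrow> 'm \<Rightarrow> 'a::real_inner \<Rightarrow> real" where
  "freg \<beta> p f t i x = f i x + \<beta> / (2 * t powr p) * (norm x)\<^sup>2"

definition A3 :: "('m::finite \<Rightarrow> 'a::real_inner \<Rightarrow> real) \<Rightarrow> real \<Rightarrow> real \<Rightarrow> real \<Rightarrow> 'a \<Rightarrow> 'a \<Rightarrow> bool" where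
  "A3 f \<beta> p t0 x0 v0 \<longleftrightarrow>
    (let a = \<beta> / (2 * t0 powr p) * (norm x0)\<^sup>2 + (norm v0)\<^sup>2 / 2;
         b = (\<lambda>i. f i x0 + a)
     in (\<forall>x \<in> level_set f b. LPw f (\<lambda>i. f i x) \<noteq> {}) \<and>
        (\<exists>R. \<forall>y \<in> LPw f b. (INF z \<in> {z. \<forall>i. f i z = f i y}. norm z) \<le> R))"

definition A4 :: "('m::finite \<Rightarrow> 'a::real_inner \<Rightarrow> real) \<Rightarrow> bool" where
  "A4 f \<longleftrightarrow>
    (\<forall>w. argmin_set (\<lambda>z. Max (range (\<lambda>i. f i z - w i))) \<noteq> {}) \<and>
    continuous_on UNIV (\<lambda>w. proj (argmin_set (\<lambda>z. Max (range (\<lambda>i. f i z - w i)))) 0)"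

definition MTRIGS_solution ::
  "('m::finite \<Rightarrow> 'a::real_inner \<Rightarrow> 'a) \<Rightarrow> real \<Rightarrow> real \<Rightarrow> real \<Rightarrow> real \<Rightarrow> real \<Rightarrow> 'a \<Rightarrow> 'a
   \<Rightarrow> (real \<Rightarrow> 'a) \<Rightarrow> (real \<Rightarrow> 'a) \<Rightarrow> (real \<Rightarrow> 'a) \<Rightarrow> bool" where
  "MTRIGS_solution g t0 \<alpha> \<beta> q p x0 v0 x v acc \<longleftrightarrow>
     (\<forall>t\<ge>t0. (x has_vector_derivative v t) (at t within {t0..})) \<and>
     continuous_on {t0..} v \<and>
     (\<forall>T\<ge>t0. abs_cont_on {t0..T} v) \<and>
     (AE t in lebesgue. t \<ge> t0 \<longrightarrow> (v has_vector_derivative acc t) (at t)) \<and>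
     (AE t in lebesgue. t \<ge> t0 \<longrightarrow>
        (\<alpha> / t powr q) *\<^sub>R v t +
        proj ((\<lambda>c. c + (\<beta> / t powr p) *\<^sub>R x t + acc t) ` (convex hull (range (\<lambda>i. g i (x t))))) 0 = 0) \<and>
     x t0 = x0 \<and> v t0 = v0"

definition merit_t :: "real \<Rightarrow> real \<Rightarrow> ('m::finite \<Rightarrow> 'a::real_inner \<Rightarrow> real) \<Rightarrow> real \<Rightarrow> 'a \<Rightarrow> ereal" where
  "merit_t \<beta> p f t = merit (freg \<beta> p f t)"

definition zpt :: "real \<Rightarrow> real \<Rightarrow> ('m::finite \<Rightarrow> 'a::real_inner \<Rightarrow> real) \<Rightarrow> real \<Rightarrow> 'a \<Rightarrow> 'a" where
  "zpt \<beta> p f t y = (THE z. z \<in> argmin_set (\<lambda>z. Max (range (\<lambda>i. freg \<beta> p f t i z - freg \<beta> p f t i y))))"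

definition energy ::
  "real \<Rightarrow> real \<Rightarrow> real \<Rightarrow> real \<Rightarrow> ('m::finite \<Rightarrow> 'a::real_inner \<Rightarrow> real) \<Rightarrow> (real \<Rightarrow> 'a) \<Rightarrow> (real \<Rightarrow> 'a)
   \<Rightarrow> real \<Rightarrow> real \<Rightarrow> real \<Rightarrow> ereal" where
  "energy \<alpha> \<beta> q p f x v r lam t =
     ereal (t powr (2*r)) * merit_t \<beta> p f t (x t)
     + ereal ((norm (lam *\<^sub>R (x t - zpt \<beta> p f t (x t)) + (t powr r) *\<^sub>R v t))\<^sup>2 / 2
     + lam / 2 * (r * t powr (r-1) + \<alpha> * t powr (r-q) - 2*lam) * (norm (x t - zpt \<beta> p f t (x t)))\<^sup>2)"

end

(* Since z(t) depends on x(t), it need not be differentiable, so the energy is never differentiated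
   along z(t).  Instead z is frozen.  With theta(t) = lam t^(1-r) / (1-r), the derivative of
     exp theta * (f_{t,i}(x) - f_{t,i}(z) + |v|^2/2 + lam t^(-r) <x-z,v> + (lam/2) kappa |x-z|^2 - K t^(r-p-1))
   is nonpositive at every index i that attains the minimum over i, for almost all t beyond a time T
   that is independent of z in a fixed ball.  Here the bracket without K is t^(-2r) times the energy
   with z(t) replaced by z, and K absorbs the drift (p beta / 2) t^(-p-1) |z|^2 of the Tikhonov term.
   Hence the minimum over i decreases on [T,t]; evaluating at the end time with z := z(t), which is
   bounded by (A3) and (A4), gives the energy bound, because exp(-theta) decays faster than any power. *)

theory Submission
  imports Defs "HOL-Real_Asymp.Real_Asymp"
begin

text \<open>The logarithmic derivative of the weight is \<open>lam t^(-r)\<close>, the coefficient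
  of the cross term. Differentiating \<open><x-z, v>\<close> brings in the acceleration, which
  yields at most \<open>-lam t^(-r)\<close> times the regularized gap, and this is what the weight
  adds back. The exponent of the \<open>K\<close> term follows: \<open>r-p-1\<close> is the exponent
  \<open>-p-1\<close> of the drift minus the exponent \<open>-r\<close> of the damping. The
  acceleration contains an unknown convex combination of the gradients. Convexity bounds its product
  with \<open>x-z\<close> from below only by the least of the gaps \<open>f_j(x) - f_j(z)\<close>,
  which forces the minimum over the indices. That minimum is nonsmooth and depends on a velocity
  that is merely absolutely continuous, so its monotonicity is drawn directly from the epsilon-delta
  notion and from difference bounds off a null set, without integrating the acceleration. The ranges
  of the parameters are sign conditions: \<open>lam \<le> 2*\<alpha>/3\<close> and
  \<open>q \<le> r\<close> for \<open>|v|^2\<close>, \<open>lam \<le> \<beta>/\<alpha>\<close> and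
  \<open>p-q \<le> r\<close> for \<open>|x-z|^2\<close>. With \<open>r < 1\<close> the derivatives
  of the powers of \<open>t\<close> are eventually negligible against the damping.\<close>

section \<open>Monotonicity of absolutely continuous functions\<close>

text \<open>Cousin's lemma delivers tagged divisions, while \<open>abs_cont_on\<close> speaks of
  finite sequences of non-overlapping intervals. Enumerating the members of positive length
  translates one into the other.\<close>

lemma abs_cont_on_tagged:
  assumes ac: "abs_cont_on {a..b} h" and "e > 0"
  obtains d where "d > 0"
    and "\<And>q. \<lbrakk>q tagged_partial_division_of {a..b}; (\<Sum>(x,K)\<in>q. measure lborel K) < d\<rbrakk>
      \<Longrightarrow> (\<Sum>(x,K)\<in>q. norm (h (Sup K) - h (Inf K))) < e"
proof -
  obtain d where "d > 0" and d: "\<forall>n (A::nat \<Rightarrow> real) B.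
       (\<forall>k<n. A k \<le> B k \<and> {A k..B k} \<subseteq> {a..b}) \<and>
       (\<forall>j<n. \<forall>k<n. j \<noteq> k \<longrightarrow> B j \<le> A k \<or> B k \<le> A j) \<and> (\<Sum>k<n. B k - A k) < d
       \<longrightarrow> (\<Sum>k<n. norm (h (B k) - h (A k))) < e"
    using ac[unfolded abs_cont_on_def, THEN spec, THEN mp, OF \<open>e > 0\<close>] by (elim exE conjE)
  have "(\<Sum>(x,K)\<in>q. norm (h (Sup K) - h (Inf K))) < e"
    if q: "q tagged_partial_division_of {a..b}" and small: "(\<Sum>(x,K)\<in>q. measure lborel K) < d" for q
  proof -
    have fin: "finite q" using q by (simp add: tagged_partial_division_of_def)
    have int: "K = {Inf K..Sup K} \<and> Inf K \<le> Sup K \<and> K \<subseteq> {a..b}" if "(x,K) \<in> q" for x K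
    proof -
      have "x \<in> K" "K \<subseteq> {a..b}" "\<exists>l u. K = cbox l u"
        using q that unfolding tagged_partial_division_of_def by blast+
      then obtain l u where "K = {l..u}" "l \<le> u" by force
      then show ?thesis using \<open>K \<subseteq> {a..b}\<close> by auto
    qed
    have sep: "Sup K \<le> Inf L \<or> Sup L \<le> Inf K"
      if "(x,K) \<in> q" "(y,L) \<in> q" "(x,K) \<noteq> (y,L)" "Inf K < Sup K" "Inf L < Sup L" for x y K L
    proof (rule ccontr)
      assume "\<not> ?thesis"
      then have m: "max (Inf K) (Inf L) < min (Sup K) (Sup L)" using that by auto
      have "interior K \<inter> interior L = {}"
        using q that(1-3) unfolding tagged_partial_division_of_def by blast
      moreover have "interior K = {Inf K<..<Sup K}"
        by (subst int[OF that(1), THEN conjunct1]) (rule interior_atLeastAtMost_real)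
      moreover have "interior L = {Inf L<..<Sup L}"
        by (subst int[OF that(2), THEN conjunct1]) (rule interior_atLeastAtMost_real)
      ultimately show False using dense[OF m] by auto
    qed
    \<comment> \<open>A degenerate interval may lie inside another member of the division, so it has to be dropped.\<close>
    define q' where "q' = {(x,K)\<in>q. Inf K < Sup K}"
    have sub: "q' \<subseteq> q" unfolding q'_def by auto
    have fin': "finite q'" using fin sub finite_subset by blast
    obtain \<sigma> where \<sigma>: "bij_betw \<sigma> {0..<card q'} q'" using ex_bij_betw_nat_finite[OF fin'] by blast
    have \<sigma>q: "\<sigma> k \<in> q'" if "k < card q'" for k using \<sigma> that by (auto simp: bij_betw_def)
    have reidx: "(\<Sum>k<card q'. w (snd (\<sigma> k))) = (\<Sum>(x,K)\<in>q'. w K)" for w :: "real set \<Rightarrow> real"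
      using sum.reindex_bij_betw[OF \<sigma>, of "\<lambda>z. w (snd z)"]
      by (simp add: atLeast0LessThan case_prod_unfold)
    have sum_eq: "(\<Sum>(x,K)\<in>q. w K) = (\<Sum>(x,K)\<in>q'. w K)"
      if "\<And>x K. (x,K) \<in> q \<Longrightarrow> Inf K = Sup K \<Longrightarrow> w K = 0" for w :: "real set \<Rightarrow> real"
    proof (rule sum.mono_neutral_right[OF fin sub])
      show "\<forall>z\<in>q - q'. (case z of (x, K) \<Rightarrow> w K) = 0"
      proof (clarify)
        fix x K assume "(x,K) \<in> q" "(x,K) \<notin> q'"
        with int[of x K] have "Inf K = Sup K" by (auto simp: q'_def)
        with that \<open>(x,K) \<in> q\<close> show "w K = 0" by blast
      qed
    qed
    have content: "measure lborel K = Sup K - Inf K" if "(x,K) \<in> q" for x K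
    proof -
      have "measure lborel {Inf K..Sup K} = Sup K - Inf K"
        using int[OF that] by (intro content_real) blast
      then show ?thesis by (simp only: int[OF that, THEN conjunct1, symmetric])
    qed
    have "(\<Sum>k<card q'. norm (h (Sup (snd (\<sigma> k))) - h (Inf (snd (\<sigma> k))))) < e"
    proof (rule d[THEN spec, THEN spec, THEN spec, THEN mp], intro conjI)
      show "\<forall>k<card q'. Inf (snd (\<sigma> k)) \<le> Sup (snd (\<sigma> k)) \<and> {Inf (snd (\<sigma> k))..Sup (snd (\<sigma> k))} \<subseteq> {a..b}"
      proof (intro allI impI)
        fix k assume "k < card q'"
        then have "(fst (\<sigma> k), snd (\<sigma> k)) \<in> q" using \<sigma>q sub by auto
        from int[OF this] show "Inf (snd (\<sigma> k)) \<le> Sup (snd (\<sigma> k)) \<and> {Inf (snd (\<sigma> k))..Sup (snd (\<sigma> k))} \<subseteq> {a..b}"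
          by simp
      qed
      show "\<forall>j<card q'. \<forall>k<card q'. j \<noteq> k \<longrightarrow>
          Sup (snd (\<sigma> j)) \<le> Inf (snd (\<sigma> k)) \<or> Sup (snd (\<sigma> k)) \<le> Inf (snd (\<sigma> j))"
      proof (intro allI impI)
        fix j k assume jk: "j < card q'" "k < card q'" "j \<noteq> k"
        then have "\<sigma> j \<noteq> \<sigma> k" using \<sigma> by (auto simp: bij_betw_def inj_on_def)
        then show "Sup (snd (\<sigma> j)) \<le> Inf (snd (\<sigma> k)) \<or> Sup (snd (\<sigma> k)) \<le> Inf (snd (\<sigma> j))"
          using sep[of "fst (\<sigma> j)" "snd (\<sigma> j)" "fst (\<sigma> k)" "snd (\<sigma> k)"] \<sigma>q[OF jk(1)] \<sigma>q[OF jk(2)]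
          by (auto simp: q'_def)
      qed
      have "(\<Sum>k<card q'. Sup (snd (\<sigma> k)) - Inf (snd (\<sigma> k))) = (\<Sum>(x,K)\<in>q'. Sup K - Inf K)"
        by (rule reidx)
      also have "\<dots> = (\<Sum>(x,K)\<in>q. Sup K - Inf K)" by (rule sum_eq[symmetric]) auto
      also have "\<dots> = (\<Sum>(x,K)\<in>q. measure lborel K)" by (rule sum.cong) (auto simp: content)
      finally show "(\<Sum>k<card q'. Sup (snd (\<sigma> k)) - Inf (snd (\<sigma> k))) < d" using small by simp
    qed
    then show ?thesis
      unfolding reidx[of "\<lambda>K. norm (h (Sup K) - h (Inf K))"]
      by (subst sum_eq) auto
  qed
  with \<open>d > 0\<close> show thesis by (rule that)
qed

text \<open>Cousin's lemma with two gauges: one makes the intervals tagged in the null set short in total,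
  where absolute continuity applies; the other makes each remaining increment small.\<close>

lemma abs_cont_on_antimono:
  fixes h :: "real \<Rightarrow> real"
  assumes "a \<le> b" and ac: "abs_cont_on {a..b} h" and N: "negligible N"
    and loc: "\<And>t \<epsilon>. t \<in> {a..b} - N \<Longrightarrow> \<epsilon> > 0 \<Longrightarrow> \<exists>d>0. \<forall>y\<in>{a..b}. \<bar>y - t\<bar> < d \<longrightarrow>
      (t \<le> y \<longrightarrow> h y - h t \<le> \<epsilon> * (y - t)) \<and> (y \<le> t \<longrightarrow> h t - h y \<le> \<epsilon> * (t - y))"
  shows "h b \<le> h a"
proof (rule field_le_epsilon)
  fix e :: real assume "e > 0"
  \<comment> \<open>The summand \<open>1\<close> keeps the denominator positive when
    \<open>a = b\<close>.\<close>
  define \<epsilon> where "\<epsilon> = e / (2 * (b - a + 1))"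
  have "\<epsilon> > 0" and \<epsilon>: "\<epsilon> * (b - a) \<le> e / 2"
    using \<open>e > 0\<close> \<open>a \<le> b\<close> by (auto simp: \<epsilon>_def field_simps)
  obtain \<delta> where "\<delta> > 0" and \<delta>: "\<And>q. \<lbrakk>q tagged_partial_division_of {a..b};
      (\<Sum>(x,K)\<in>q. measure lborel K) < \<delta>\<rbrakk> \<Longrightarrow> (\<Sum>(x,K)\<in>q. norm (h (Sup K) - h (Inf K))) < e/2"
    using abs_cont_on_tagged[OF ac, of "e/2"] \<open>e > 0\<close> by auto
  \<comment> \<open>The Riemann sum of the indicator of \<open>N\<close> is the total length of the
    intervals tagged in \<open>N\<close>. Its integral being 0 gives a gauge that makes this length
    less than \<open>\<delta>\<close>.\<close>
  have "((indicator N :: real \<Rightarrow> real) has_integral 0) {a..b}"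
    using N unfolding negligible_def by (metis box_real(2))
  then obtain \<gamma> where "gauge \<gamma>" and \<gamma>: "\<And>D. \<lbrakk>D tagged_division_of {a..b}; \<gamma> fine D\<rbrakk>
      \<Longrightarrow> norm ((\<Sum>(x,K)\<in>D. measure lborel K *\<^sub>R (indicator N x :: real)) - 0) < \<delta>"
    using \<open>\<delta> > 0\<close> unfolding has_integral_real by meson
  \<comment> \<open>Tags in \<open>N\<close> satisfy \<open>P\<close> with any positive radius, so
    that \<open>d\<close> yields a gauge on the whole line.\<close>
  define P where "P t d \<longleftrightarrow> d > 0 \<and> (t \<in> {a..b} - N \<longrightarrow> (\<forall>y\<in>{a..b}. \<bar>y - t\<bar> < d \<longrightarrow>
      (t \<le> y \<longrightarrow> h y - h t \<le> \<epsilon> * (y - t)) \<and> (y \<le> t \<longrightarrow> h t - h y \<le> \<epsilon> * (t - y))))" for t d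
  have "\<exists>d. P t d" for t
  proof (cases "t \<in> {a..b} - N")
    case True
    then show ?thesis unfolding P_def using loc[OF True \<open>\<epsilon> > 0\<close>] by blast
  next
    case False
    then show ?thesis unfolding P_def by (intro exI[of _ 1]) auto
  qed
  then obtain d where d: "\<And>t. P t (d t)" by metis
  have "gauge (\<lambda>t. ball t (d t))" using d by (auto simp: P_def gauge_def)
  with \<open>gauge \<gamma>\<close> have "gauge (\<lambda>t. \<gamma> t \<inter> ball t (d t))" by (rule gauge_Int)
  then obtain D where D: "D tagged_division_of {a..b}" and fine: "(\<lambda>t. \<gamma> t \<inter> ball t (d t)) fine D"
    by (rule fine_division_exists_real)
  have finD: "finite D" using D by blast
  define D1 where "D1 = {(x,K)\<in>D. x \<in> N}"
  define D2 where "D2 = {(x,K)\<in>D. x \<notin> N}"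
  have split: "(\<Sum>z\<in>D. w z) = (\<Sum>z\<in>D1. w z) + (\<Sum>z\<in>D2. w z)" for w :: "_ \<Rightarrow> real"
  proof -
    have "D1 \<union> D2 = D" "D1 \<inter> D2 = {}" "finite D1" "finite D2"
      using finite_subset[OF _ finD, of D1] finite_subset[OF _ finD, of D2]
      by (auto simp: D1_def D2_def)
    then show ?thesis using sum.union_disjoint[of D1 D2 w] by simp
  qed
  have int: "\<exists>l u. K = {l..u} \<and> l \<le> x \<and> x \<le> u \<and> a \<le> l \<and> u \<le> b \<and> Inf K = l \<and> Sup K = u"
    if "(x,K) \<in> D" for x K
  proof -
    have "x \<in> K" "K \<subseteq> {a..b}" "\<exists>l u. K = cbox l u" using D that by blast+
    then obtain l u where "K = {l..u}" by auto
    with \<open>x \<in> K\<close> \<open>K \<subseteq> {a..b}\<close> show ?thesis by (intro exI[of _ l] exI[of _ u]) auto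
  qed
  have "h b - h a = (\<Sum>(x,K)\<in>D. h (Sup K) - h (Inf K))"
    using additive_tagged_division_1[OF \<open>a \<le> b\<close> D, of h] by simp
  also have "\<dots> = (\<Sum>(x,K)\<in>D1. h (Sup K) - h (Inf K)) + (\<Sum>(x,K)\<in>D2. h (Sup K) - h (Inf K))"
    by (rule split)
  also have "(\<Sum>(x,K)\<in>D1. h (Sup K) - h (Inf K)) \<le> (\<Sum>(x,K)\<in>D1. norm (h (Sup K) - h (Inf K)))"
    by (rule sum_mono) auto
  also have "\<dots> \<le> e / 2"
  proof (rule less_imp_le, rule \<delta>)
    show "D1 tagged_partial_division_of {a..b}"
      using D unfolding tagged_division_of_def
      by (auto intro: tagged_partial_division_subset simp: D1_def)
    have "\<gamma> fine D" using fine by (auto simp: fine_def)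
    then have "(\<Sum>(x,K)\<in>D. measure lborel K *\<^sub>R (indicator N x :: real)) < \<delta>"
      using \<gamma>[OF D] by (simp add: case_prod_unfold)
    also have "(\<Sum>(x,K)\<in>D. measure lborel K *\<^sub>R (indicator N x :: real)) = (\<Sum>(x,K)\<in>D1. measure lborel K)"
    proof -
      have "(\<Sum>(x,K)\<in>D1. measure lborel K *\<^sub>R (indicator N x :: real)) = (\<Sum>(x,K)\<in>D1. measure lborel K)"
        by (rule sum.cong) (auto simp: D1_def)
      moreover have "(\<Sum>(x,K)\<in>D2. measure lborel K *\<^sub>R (indicator N x :: real)) = 0"
        by (rule sum.neutral) (auto simp: D2_def)
      ultimately show ?thesis
        using split[of "\<lambda>(x,K). measure lborel K *\<^sub>R (indicator N x :: real)"] by simp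
    qed
    finally show "(\<Sum>(x,K)\<in>D1. measure lborel K) < \<delta>" .
  qed
  also have "(\<Sum>(x,K)\<in>D2. h (Sup K) - h (Inf K)) \<le> (\<Sum>(x,K)\<in>D2. \<epsilon> * (Sup K - Inf K))"
  proof (rule sum_mono, clarify)
    fix x K assume "(x,K) \<in> D2"
    then have xK: "(x,K) \<in> D" "x \<notin> N" by (auto simp: D2_def)
    then obtain l u where K: "K = {l..u}" "l \<le> x" "x \<le> u" "a \<le> l" "u \<le> b" "Inf K = l" "Sup K = u"
      using int[of x K] by blast
    have "K \<subseteq> ball x (d x)" using fine xK by (auto simp: fine_def)
    then have "l \<in> ball x (d x)" "u \<in> ball x (d x)" using K(1-3) by (meson atLeastAtMost_iff order.refl order.trans subsetD)+
    then have "\<bar>l - x\<bar> < d x" "\<bar>u - x\<bar> < d x" by (auto simp: dist_real_def)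
    moreover have "x \<in> {a..b} - N" "l \<in> {a..b}" "u \<in> {a..b}" using K xK by auto
    \<comment> \<open>The tag lies between the endpoints, so the increment splits into one on each
      side of the tag; this is why \<open>loc\<close> bounds both sides.\<close>
    ultimately have "h x - h l \<le> \<epsilon> * (x - l)" "h u - h x \<le> \<epsilon> * (u - x)"
      using d[of x] K unfolding P_def by blast+
    then show "h (Sup K) - h (Inf K) \<le> \<epsilon> * (Sup K - Inf K)" using K by (simp add: algebra_simps)
  qed
  also have "\<dots> \<le> (\<Sum>(x,K)\<in>D. \<epsilon> * (Sup K - Inf K))"
  proof -
    have "0 \<le> (\<Sum>(x,K)\<in>D1. \<epsilon> * (Sup K - Inf K))"
    proof (rule sum_nonneg, clarify)
      fix x K assume "(x,K) \<in> D1"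
      then have "Inf K \<le> Sup K" using int[of x K] by (auto simp: D1_def)
      then show "0 \<le> \<epsilon> * (Sup K - Inf K)" using \<open>\<epsilon> > 0\<close> by simp
    qed
    then show ?thesis unfolding split[of "\<lambda>(x,K). \<epsilon> * (Sup K - Inf K)"] by simp
  qed
  also have "\<dots> = \<epsilon> * (b - a)"
    using additive_tagged_division_1[OF \<open>a \<le> b\<close> D, of "\<lambda>x. x"]
    by (simp add: sum_distrib_left[symmetric] case_prod_unfold)
  also have "\<dots> \<le> e / 2" by (rule \<epsilon>)
  finally show "h b \<le> h a + e" by simp
qed

section \<open>Transfer of absolute continuity through dominated increments\<close>

lemma abs_cont_on_subset:
  assumes "abs_cont_on S h" and "T \<subseteq> S"
  shows "abs_cont_on T h"
  unfolding abs_cont_on_def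
proof (intro allI impI)
  fix e :: real assume "e > 0"
  obtain d where "d > 0" and d: "\<forall>n (a::nat \<Rightarrow> real) b.
       (\<forall>k<n. a k \<le> b k \<and> {a k..b k} \<subseteq> S) \<and>
       (\<forall>j<n. \<forall>k<n. j \<noteq> k \<longrightarrow> b j \<le> a k \<or> b k \<le> a j) \<and> (\<Sum>k<n. b k - a k) < d
       \<longrightarrow> (\<Sum>k<n. norm (h (b k) - h (a k))) < e"
    using assms(1)[unfolded abs_cont_on_def, THEN spec, THEN mp, OF \<open>e > 0\<close>] by (elim exE conjE)
  show "\<exists>\<delta>>0. \<forall>n (a::nat \<Rightarrow> real) b.
       (\<forall>k<n. a k \<le> b k \<and> {a k..b k} \<subseteq> T) \<and>
       (\<forall>j<n. \<forall>k<n. j \<noteq> k \<longrightarrow> b j \<le> a k \<or> b k \<le> a j) \<and> (\<Sum>k<n. b k - a k) < \<delta> \<longrightarrow>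
       (\<Sum>k<n. norm (h (b k) - h (a k))) < e"
  proof (intro exI[of _ d] conjI allI impI \<open>d > 0\<close>)
    fix n and a b :: "nat \<Rightarrow> real"
    assume A: "(\<forall>k<n. a k \<le> b k \<and> {a k..b k} \<subseteq> T) \<and>
       (\<forall>j<n. \<forall>k<n. j \<noteq> k \<longrightarrow> b j \<le> a k \<or> b k \<le> a j) \<and> (\<Sum>k<n. b k - a k) < d"
    then have "\<forall>k<n. a k \<le> b k \<and> {a k..b k} \<subseteq> S" using \<open>T \<subseteq> S\<close> by (meson order_trans)
    with A show "(\<Sum>k<n. norm (h (b k) - h (a k))) < e"
      by (intro d[THEN spec, THEN spec, THEN spec, THEN mp]) simp
  qed
qed

lemma abs_cont_on_dominated:
  assumes ac: "abs_cont_on S v"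
    and dom: "\<And>s t. s \<in> S \<Longrightarrow> t \<in> S \<Longrightarrow> s \<le> t \<Longrightarrow> norm (h t - h s) \<le> C * (norm (v t - v s) + (t - s))"
  shows "abs_cont_on S h"
  unfolding abs_cont_on_def
proof (intro allI impI)
  fix e :: real assume "e > 0"
  define B where "B = \<bar>C\<bar> + 1"
  have "B > 0" by (simp add: B_def)
  with \<open>e > 0\<close> have "e / (2 * B) > 0" by simp
  then obtain d where "d > 0" and d: "\<forall>n (A::nat \<Rightarrow> real) B'.
       (\<forall>k<n. A k \<le> B' k \<and> {A k..B' k} \<subseteq> S) \<and>
       (\<forall>j<n. \<forall>k<n. j \<noteq> k \<longrightarrow> B' j \<le> A k \<or> B' k \<le> A j) \<and> (\<Sum>k<n. B' k - A k) < d
       \<longrightarrow> (\<Sum>k<n. norm (v (B' k) - v (A k))) < e / (2 * B)"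
    using ac[unfolded abs_cont_on_def, THEN spec, THEN mp, OF \<open>e / (2 * B) > 0\<close>]
    by (elim exE conjE)
  show "\<exists>\<delta>>0. \<forall>n (a::nat \<Rightarrow> real) b.
       (\<forall>k<n. a k \<le> b k \<and> {a k..b k} \<subseteq> S) \<and>
       (\<forall>j<n. \<forall>k<n. j \<noteq> k \<longrightarrow> b j \<le> a k \<or> b k \<le> a j) \<and> (\<Sum>k<n. b k - a k) < \<delta> \<longrightarrow>
       (\<Sum>k<n. norm (h (b k) - h (a k))) < e"
  proof (intro exI[of _ "min d (e / (2 * B))"] conjI allI impI)
    show "0 < min d (e / (2 * B))" using \<open>d > 0\<close> \<open>e > 0\<close> \<open>B > 0\<close> by simp
    fix n and a b :: "nat \<Rightarrow> real"
    assume A: "(\<forall>k<n. a k \<le> b k \<and> {a k..b k} \<subseteq> S) \<and>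
       (\<forall>j<n. \<forall>k<n. j \<noteq> k \<longrightarrow> b j \<le> a k \<or> b k \<le> a j) \<and> (\<Sum>k<n. b k - a k) < min d (e / (2 * B))"
    have "(\<Sum>k<n. norm (h (b k) - h (a k))) \<le> (\<Sum>k<n. B * (norm (v (b k) - v (a k)) + (b k - a k)))"
    proof (rule sum_mono)
      fix k assume "k \<in> {..<n}"
      then have k: "a k \<le> b k" "a k \<in> S" "b k \<in> S" using A by (auto simp: subset_iff)
      then have "norm (h (b k) - h (a k)) \<le> C * (norm (v (b k) - v (a k)) + (b k - a k))"
        by (intro dom) auto
      also have "\<dots> \<le> B * (norm (v (b k) - v (a k)) + (b k - a k))"
        using k by (intro mult_right_mono) (auto simp: B_def)
      finally show "norm (h (b k) - h (a k)) \<le> B * (norm (v (b k) - v (a k)) + (b k - a k))" .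
    qed
    also have "\<dots> = B * ((\<Sum>k<n. norm (v (b k) - v (a k))) + (\<Sum>k<n. b k - a k))"
      by (simp add: sum_distrib_left[symmetric] sum.distrib)
    also have "\<dots> < B * (e / (2 * B) + e / (2 * B))"
      using d[THEN spec, THEN spec, THEN spec, THEN mp, of n a b] A \<open>B > 0\<close>
      by (intro mult_strict_left_mono add_strict_mono) auto
    also have "\<dots> = e" using \<open>B > 0\<close> by simp
    finally show "(\<Sum>k<n. norm (h (b k) - h (a k))) < e" .
  qed
qed

text \<open>Absolute continuity passes from \<open>v\<close> to \<open>h\<close> under this domination, which, unlike absolute
  continuity as defined, is closed under bilinear products by a one-line estimate.\<close>

definition inc_dominated :: "real set \<Rightarrow> (real \<Rightarrow> 'a::real_normed_vector) \<Rightarrow> (real \<Rightarrow> 'b::real_normed_vector) \<Rightarrow> bool"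
  where "inc_dominated S v h \<longleftrightarrow>
    (\<exists>C. \<forall>s\<in>S. \<forall>t\<in>S. norm (h t - h s) \<le> C * (norm (v t - v s) + \<bar>t - s\<bar>))"

lemma inc_dominatedE:
  assumes "inc_dominated S v h"
  obtains C where "C > 0"
    and "\<And>s t. s \<in> S \<Longrightarrow> t \<in> S \<Longrightarrow> norm (h t - h s) \<le> C * (norm (v t - v s) + \<bar>t - s\<bar>)"
proof -
  obtain C where C: "\<And>s t. s \<in> S \<Longrightarrow> t \<in> S \<Longrightarrow> norm (h t - h s) \<le> C * (norm (v t - v s) + \<bar>t - s\<bar>)"
    using assms unfolding inc_dominated_def by blast
  show thesis
  proof (rule that[of "\<bar>C\<bar> + 1"])
    show "\<bar>C\<bar> + 1 > 0" by simp
    fix s t assume "s \<in> S" "t \<in> S"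
    then have "norm (h t - h s) \<le> C * (norm (v t - v s) + \<bar>t - s\<bar>)" by (rule C)
    also have "\<dots> \<le> (\<bar>C\<bar> + 1) * (norm (v t - v s) + \<bar>t - s\<bar>)" by (intro mult_right_mono) auto
    finally show "norm (h t - h s) \<le> (\<bar>C\<bar> + 1) * (norm (v t - v s) + \<bar>t - s\<bar>)" .
  qed
qed

lemma inc_dominated_self: "inc_dominated S v v"
  unfolding inc_dominated_def by (intro exI[of _ 1]) auto

lemma inc_dominated_add:
  assumes "inc_dominated S v f" "inc_dominated S v g"
  shows "inc_dominated S v (\<lambda>t. f t + g t)"
proof -
  obtain C where C: "\<And>s t. s \<in> S \<Longrightarrow> t \<in> S \<Longrightarrow> norm (f t - f s) \<le> C * (norm (v t - v s) + \<bar>t - s\<bar>)"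
    using assms(1) by (rule inc_dominatedE) blast
  obtain D where D: "\<And>s t. s \<in> S \<Longrightarrow> t \<in> S \<Longrightarrow> norm (g t - g s) \<le> D * (norm (v t - v s) + \<bar>t - s\<bar>)"
    using assms(2) by (rule inc_dominatedE) blast
  show ?thesis unfolding inc_dominated_def
  proof (intro exI[of _ "C + D"] ballI)
    fix s t assume "s \<in> S" "t \<in> S"
    then show "norm (f t + g t - (f s + g s)) \<le> (C + D) * (norm (v t - v s) + \<bar>t - s\<bar>)"
      using C[of s t] D[of s t] norm_triangle_ineq[of "f t - f s" "g t - g s"]
      by (simp add: algebra_simps)
  qed
qed

text \<open>A continuous derivative is bounded on the compact interval, so \<open>h\<close> is
  Lipschitz there and the length term alone dominates its increments.\<close>

lemma inc_dominated_C1: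
  fixes h :: "real \<Rightarrow> 'b::real_normed_vector"
  assumes "\<And>t. t \<in> {a..b} \<Longrightarrow> (h has_vector_derivative h' t) (at t within {a..b})"
    and "continuous_on {a..b} h'"
  shows "inc_dominated {a..b} v h"
proof -
  have "bounded (h' ` {a..b})"
    using assms(2) by (intro compact_imp_bounded compact_continuous_image) auto
  then obtain C where "C > 0" and C: "\<And>t. t \<in> {a..b} \<Longrightarrow> norm (h' t) \<le> C"
    unfolding bounded_pos by auto
  have lip: "norm (h t - h s) \<le> C * norm (t - s)" if "s \<in> {a..b}" "t \<in> {a..b}" for s t
  proof (rule differentiable_bound[of "{a..b}" h "\<lambda>t x. x *\<^sub>R h' t"])
    show "(h has_derivative (\<lambda>x. x *\<^sub>R h' u)) (at u within {a..b})" if "u \<in> {a..b}" for u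
      using assms(1)[OF that] by (simp add: has_vector_derivative_def)
    show "onorm (\<lambda>x. x *\<^sub>R h' u) \<le> C" if "u \<in> {a..b}" for u
      using C[OF that] by (intro onorm_le) (simp add: mult.commute[of C] mult_left_mono)
  qed (use that in auto)
  then have "norm (h t - h s) \<le> C * (norm (v t - v s) + \<bar>t - s\<bar>)" if "s \<in> {a..b}" "t \<in> {a..b}" for s t
  proof -
    have "C * \<bar>t - s\<bar> \<le> C * (norm (v t - v s) + \<bar>t - s\<bar>)"
      using \<open>C > 0\<close> by (intro mult_left_mono) auto
    moreover have "norm (h t - h s) \<le> C * \<bar>t - s\<bar>"
      using lip[OF that] by simp
    ultimately show ?thesis by linarith
  qed
  then show ?thesis unfolding inc_dominated_def by blast
qed

lemma inc_dominated_bounded: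
  assumes "inc_dominated S v h" "bounded S" "bounded (v ` S)"
  shows "bounded (h ` S)"
proof (cases "S = {}")
  case False
  then obtain s where s: "s \<in> S" by blast
  obtain C where "C > 0" and C: "\<And>s t. s \<in> S \<Longrightarrow> t \<in> S \<Longrightarrow> norm (h t - h s) \<le> C * (norm (v t - v s) + \<bar>t - s\<bar>)"
    using assms(1) by (rule inc_dominatedE) blast
  obtain A B where A: "\<And>t. t \<in> S \<Longrightarrow> norm t \<le> A" and B: "\<And>t. t \<in> S \<Longrightarrow> norm (v t) \<le> B"
    using assms(2,3) unfolding bounded_iff by auto
  have "norm (h t) \<le> norm (h s) + C * (B + B + (A + A))" if "t \<in> S" for t
  proof -
    have "norm (v t - v s) \<le> B + B" "\<bar>t - s\<bar> \<le> A + A"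
      using norm_triangle_ineq4[of "v t" "v s"] A[OF s] A[OF that] B[OF s] B[OF that] by auto
    then have "C * (norm (v t - v s) + \<bar>t - s\<bar>) \<le> C * (B + B + (A + A))"
      using \<open>C > 0\<close> by (intro mult_left_mono add_mono) auto
    then show ?thesis using C[OF s that] norm_triangle_ineq2[of "h t" "h s"] by linarith
  qed
  then show ?thesis by (auto simp: bounded_iff)
qed simp

lemma (in bounded_bilinear) inc_dominated:
  assumes f: "inc_dominated S v f" and g: "inc_dominated S v g"
    and S: "bounded S" and v: "bounded (v ` S)"
  shows "inc_dominated S v (\<lambda>t. prod (f t) (g t))"
proof -
  obtain C where "C > 0" and C: "\<And>s t. s \<in> S \<Longrightarrow> t \<in> S \<Longrightarrow> norm (f t - f s) \<le> C * (norm (v t - v s) + \<bar>t - s\<bar>)"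
    using f by (rule inc_dominatedE) blast
  obtain D where "D > 0" and D: "\<And>s t. s \<in> S \<Longrightarrow> t \<in> S \<Longrightarrow> norm (g t - g s) \<le> D * (norm (v t - v s) + \<bar>t - s\<bar>)"
    using g by (rule inc_dominatedE) blast
  obtain A where "A > 0" and A: "\<And>t. t \<in> S \<Longrightarrow> norm (f t) \<le> A"
    using inc_dominated_bounded[OF f S v] unfolding bounded_pos by auto
  obtain B where "B > 0" and B: "\<And>t. t \<in> S \<Longrightarrow> norm (g t) \<le> B"
    using inc_dominated_bounded[OF g S v] unfolding bounded_pos by auto
  obtain K where "K \<ge> 0" and K: "\<And>a b. norm (prod a b) \<le> norm a * norm b * K"
    using nonneg_bounded by blast
  show ?thesis unfolding inc_dominated_def
  proof (intro exI[of _ "(C * B + A * D) * K"] ballI)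
    fix s t assume st: "s \<in> S" "t \<in> S"
    define m where "m = norm (v t - v s) + \<bar>t - s\<bar>"
    have "m \<ge> 0" by (simp add: m_def)
    have "prod (f t) (g t) - prod (f s) (g s) = prod (f t - f s) (g t) + prod (f s) (g t - g s)"
      by (simp add: diff_left diff_right)
    then have "norm (prod (f t) (g t) - prod (f s) (g s))
        \<le> norm (prod (f t - f s) (g t)) + norm (prod (f s) (g t - g s))"
      using norm_triangle_ineq by metis
    also have "\<dots> \<le> norm (f t - f s) * norm (g t) * K + norm (f s) * norm (g t - g s) * K"
      by (intro add_mono K)
    also have "\<dots> \<le> (C * m) * B * K + A * (D * m) * K"
      using A B C D st \<open>A > 0\<close> \<open>B > 0\<close> \<open>C > 0\<close> \<open>D > 0\<close> \<open>K \<ge> 0\<close> \<open>m \<ge> 0\<close> unfolding m_def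
      by (intro add_mono mult_right_mono mult_mono) auto
    finally show "norm (prod (f t) (g t) - prod (f s) (g s))
        \<le> (C * B + A * D) * K * (norm (v t - v s) + \<bar>t - s\<bar>)"
      by (simp add: m_def algebra_simps)
  qed
qed

section \<open>Minima over finitely many indices\<close>

lemma Min_range_attained:
  fixes h :: "'m::finite \<Rightarrow> 'b::linorder"
  obtains i where "Min (range h) = h i"
proof -
  have "Min (range h) \<in> range h" by (rule Min_in) auto
  then show thesis using that by (rule rangeE)
qed

lemma Max_range_attained:
  fixes h :: "'m::finite \<Rightarrow> 'b::linorder"
  obtains i where "Max (range h) = h i"
proof -
  have "Max (range h) \<in> range h" by (rule Max_in) auto
  then show thesis using that by (rule rangeE)
qed

text \<open>The sum of the constants serves all indices at once. Comparison at the index that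
  attains the minimum at \<open>s\<close> bounds the increase from \<open>s\<close> to
  \<open>t\<close>; exchanging \<open>s\<close> and \<open>t\<close> gives the other sign.\<close>

lemma inc_dominated_Min:
  fixes H :: "'m::finite \<Rightarrow> real \<Rightarrow> real"
  assumes "\<And>i. inc_dominated S v (H i)"
  shows "inc_dominated S v (\<lambda>t. Min (range (\<lambda>i. H i t)))"
proof -
  have "\<exists>C. C > 0 \<and> (\<forall>s\<in>S. \<forall>t\<in>S. norm (H i t - H i s) \<le> C * (norm (v t - v s) + \<bar>t - s\<bar>))" for i
    using inc_dominatedE[OF assms[of i]] by metis
  then obtain C where C0: "\<And>i. C i > 0" and
    C: "\<And>i s t. s \<in> S \<Longrightarrow> t \<in> S \<Longrightarrow> norm (H i t - H i s) \<le> C i * (norm (v t - v s) + \<bar>t - s\<bar>)"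
    by metis
  have le: "Min (range (\<lambda>i. H i t)) \<le> Min (range (\<lambda>i. H i s)) + sum C UNIV * (norm (v t - v s) + \<bar>t - s\<bar>)"
    if "s \<in> S" "t \<in> S" for s t
  proof -
    obtain i where i: "Min (range (\<lambda>i. H i s)) = H i s" by (rule Min_range_attained)
    have "C i \<le> sum C UNIV" by (rule member_le_sum) (auto simp: C0 less_imp_le)
    then have "C i * (norm (v t - v s) + \<bar>t - s\<bar>) \<le> sum C UNIV * (norm (v t - v s) + \<bar>t - s\<bar>)"
      by (intro mult_right_mono) auto
    moreover have "Min (range (\<lambda>i. H i t)) \<le> H i t" by simp
    moreover have "H i t - H i s \<le> C i * (norm (v t - v s) + \<bar>t - s\<bar>)"
      using C[OF that, of i] by (simp add: abs_le_iff)
    ultimately show ?thesis unfolding i by linarith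
  qed
  show ?thesis unfolding inc_dominated_def
  proof (intro exI[of _ "sum C UNIV"] ballI)
    fix s t assume "s \<in> S" "t \<in> S"
    then have "Min (range (\<lambda>i. H i t)) \<le> Min (range (\<lambda>i. H i s)) + sum C UNIV * (norm (v t - v s) + \<bar>t - s\<bar>)"
      "Min (range (\<lambda>i. H i s)) \<le> Min (range (\<lambda>i. H i t)) + sum C UNIV * (norm (v s - v t) + \<bar>s - t\<bar>)"
      by (intro le; simp)+
    then show "norm (Min (range (\<lambda>i. H i t)) - Min (range (\<lambda>i. H i s)))
        \<le> sum C UNIV * (norm (v t - v s) + \<bar>t - s\<bar>)"
      unfolding real_norm_def abs_le_iff norm_minus_commute[of "v s"] abs_minus_commute[of s] by linarith
  qed
qed

text \<open>The minimum need not be differentiable, but near \<open>t\<close> only indices active at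
  \<open>t\<close> can be active. To the right of \<open>t\<close>, an index active at
  \<open>t\<close> bounds the minimum from above. To the left, the index active at \<open>y\<close>
  is active at \<open>t\<close> as well, and its derivative bounds the increment from
  \<open>y\<close> to \<open>t\<close>.\<close>

lemma Min_antimono_if_active_deriv_nonpos:
  fixes H :: "'m::finite \<Rightarrow> real \<Rightarrow> real"
  assumes "a \<le> b" and ac: "abs_cont_on {a..b} v" and dom: "\<And>i. inc_dominated {a..b} v (H i)"
    and N: "negligible N"
    and deriv: "\<And>i t. t \<in> {a..b} - N \<Longrightarrow> (H i has_real_derivative D i t) (at t)"
    and active: "\<And>i t. t \<in> {a..b} - N \<Longrightarrow> (\<And>j. H i t \<le> H j t) \<Longrightarrow> D i t \<le> 0"
  shows "Min (range (\<lambda>i. H i b)) \<le> Min (range (\<lambda>i. H i a))"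
proof (rule abs_cont_on_antimono[OF \<open>a \<le> b\<close> _ N])
  let ?M = "\<lambda>t. Min (range (\<lambda>i. H i t))"
  obtain C where C: "\<And>s t. s \<in> {a..b} \<Longrightarrow> t \<in> {a..b}
      \<Longrightarrow> norm (?M t - ?M s) \<le> C * (norm (v t - v s) + \<bar>t - s\<bar>)"
    using inc_dominatedE[OF inc_dominated_Min[of "{a..b}" v H, OF dom]] by metis
  show "abs_cont_on {a..b} ?M"
  proof (rule abs_cont_on_dominated[OF ac])
    fix s t assume "s \<in> {a..b}" "t \<in> {a..b}" "s \<le> t"
    then show "norm (?M t - ?M s) \<le> C * (norm (v t - v s) + (t - s))" using C[of s t] by simp
  qed
  fix t \<epsilon> :: real assume t: "t \<in> {a..b} - N" and "\<epsilon> > 0"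
  have M_le: "?M y \<le> H i y" for y i by simp
  have M_ex: "\<exists>i. ?M y = H i y" for y by (metis Min_range_attained)
  obtain i0 where i0: "?M t = H i0 t" using M_ex by blast
  have cont: "isCont (H i) t" for i using DERIV_isCont[OF deriv[OF t]] .
  have ev1: "\<forall>\<^sub>F y in nhds t. \<forall>i. \<bar>H i y - H i t - D i t * (y - t)\<bar> \<le> \<epsilon> * \<bar>y - t\<bar>"
  proof (rule eventually_all_finite)
    fix i
    have "(H i has_derivative (\<lambda>x. D i t * x)) (at t)"
      using deriv[OF t, of i] by (simp add: has_field_derivative_def)
    then show "\<forall>\<^sub>F y in nhds t. \<bar>H i y - H i t - D i t * (y - t)\<bar> \<le> \<epsilon> * \<bar>y - t\<bar>"
      using \<open>\<epsilon> > 0\<close> unfolding has_derivative_at_alt eventually_nhds_metric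
      by (auto simp: dist_real_def)
  qed
  \<comment> \<open>Continuity keeps every index that is inactive at \<open>t\<close> strictly above
    \<open>H i0\<close> nearby, hence inactive.\<close>
  have ev2: "\<forall>\<^sub>F y in nhds t. \<forall>i. ?M t < H i t \<longrightarrow> H i0 y < H i y"
  proof (rule eventually_all_finite)
    fix i
    show "\<forall>\<^sub>F y in nhds t. ?M t < H i t \<longrightarrow> H i0 y < H i y"
    proof (cases "?M t < H i t")
      case True
      have "isCont (\<lambda>y. H i y - H i0 y) t" by (intro continuous_intros cont)
      then have "((\<lambda>y. H i y - H i0 y) \<longlongrightarrow> H i t - H i0 t) (nhds t)"
        using tendsto_at_iff_tendsto_nhds[of "\<lambda>y. H i y - H i0 y" t] by (simp add: isCont_def)
      moreover have "0 < H i t - H i0 t" using True i0 by simp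
      ultimately have "\<forall>\<^sub>F y in nhds t. 0 < H i y - H i0 y" by (rule order_tendstoD)
      then show ?thesis by eventually_elim simp
    qed simp
  qed
  obtain d where "d > 0" and d: "\<And>y. \<bar>y - t\<bar> < d \<Longrightarrow>
      (\<forall>i. \<bar>H i y - H i t - D i t * (y - t)\<bar> \<le> \<epsilon> * \<bar>y - t\<bar>) \<and> (\<forall>i. ?M t < H i t \<longrightarrow> H i0 y < H i y)"
    using eventually_conj[OF ev1 ev2] unfolding eventually_nhds_metric by (auto simp: dist_real_def)
  have D_nonpos: "D i t \<le> 0" if "H i t \<le> ?M t" for i
  proof (rule active[OF t])
    show "H i t \<le> H j t" for j using that M_le[of t j] by linarith
  qed
  show "\<exists>d>0. \<forall>y\<in>{a..b}. \<bar>y - t\<bar> < d \<longrightarrow>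
      (t \<le> y \<longrightarrow> ?M y - ?M t \<le> \<epsilon> * (y - t)) \<and> (y \<le> t \<longrightarrow> ?M t - ?M y \<le> \<epsilon> * (t - y))"
  proof (intro exI[of _ d] conjI ballI impI \<open>d > 0\<close>)
    fix y assume y: "\<bar>y - t\<bar> < d" "t \<le> y"
    have "H i0 y - H i0 t \<le> D i0 t * (y - t) + \<epsilon> * (y - t)"
      using d[OF y(1), THEN conjunct1, THEN spec, of i0] y(2) by (simp add: abs_le_iff)
    moreover have "D i0 t * (y - t) \<le> 0"
      using D_nonpos[of i0] i0 y(2) by (intro mult_nonpos_nonneg) auto
    ultimately show "?M y - ?M t \<le> \<epsilon> * (y - t)" using i0 M_le[of y i0] by linarith
  next
    fix y assume y: "\<bar>y - t\<bar> < d" "y \<le> t"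
    obtain j where j: "?M y = H j y" using M_ex by blast
    have "\<not> ?M t < H j t" using d[OF y(1)] M_le[of y i0] j by (metis not_less)
    then have Dj: "D j t \<le> 0" by (intro D_nonpos) (simp only: not_less)
    have "H j t - H j y \<le> D j t * (t - y) + \<epsilon> * (t - y)"
      using d[OF y(1), THEN conjunct1, THEN spec, of j] y(2)
      by (simp add: abs_le_iff algebra_simps)
    moreover have "D j t * (t - y) \<le> 0" using Dj y(2) by (intro mult_nonpos_nonneg) auto
    ultimately show "?M t - ?M y \<le> \<epsilon> * (t - y)" using j M_le[of t j] by linarith
  qed
qed

section \<open>Merit functions of regularized convex objectives\<close>

text \<open>Along the line through \<open>x\<close> and \<open>z\<close> this is the tangent
  inequality of a convex function of one real variable.\<close>

lemma convex_on_gradient_ineq: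
  fixes f :: "'a::real_inner \<Rightarrow> real"
  assumes "convex_on UNIV f" and der: "(f has_derivative (\<lambda>h. G \<bullet> h)) (at x)"
  shows "f x + G \<bullet> (z - x) \<le> f z"
proof -
  define g where "g s = f (x + s *\<^sub>R (z - x))" for s :: real
  have "convex_on UNIV g"
  proof (rule convex_onI)
    fix s a b :: real assume s: "0 < s" "s < 1"
    have "x + ((1 - s) *\<^sub>R a + s *\<^sub>R b) *\<^sub>R (z - x) =
        (1 - s) *\<^sub>R (x + a *\<^sub>R (z - x)) + s *\<^sub>R (x + b *\<^sub>R (z - x))"
      by (simp add: algebra_simps)
    then show "g ((1 - s) *\<^sub>R a + s *\<^sub>R b) \<le> (1 - s) * g a + s * g b"
      using convex_onD[OF assms(1), of s "x + a *\<^sub>R (z - x)" "x + b *\<^sub>R (z - x)"] s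
      by (simp add: g_def)
  qed simp
  moreover have "(g has_real_derivative G \<bullet> (z - x)) (at 0)"
  proof -
    have "((\<lambda>s::real. x + s *\<^sub>R (z - x)) has_derivative (\<lambda>s. s *\<^sub>R (z - x))) (at 0)"
      by (auto intro!: derivative_eq_intros)
    moreover have "(f has_derivative (\<lambda>h. G \<bullet> h)) (at (x + 0 *\<^sub>R (z - x)))" using der by simp
    ultimately have "(g has_derivative (\<lambda>s. G \<bullet> (s *\<^sub>R (z - x)))) (at 0)"
      unfolding g_def using has_derivative_compose[of "\<lambda>s. x + s *\<^sub>R (z - x)" _ 0 UNIV f] by blast
    then show ?thesis by (simp add: has_field_derivative_def mult.commute[of _ "G \<bullet> (z - x)"] mult_commute_abs)
  qed
  ultimately have "g 1 - g 0 \<ge> G \<bullet> (z - x) * (1 - 0)"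
    by (intro convex_on_imp_above_tangent[where A = UNIV]) auto
  then show ?thesis by (simp add: g_def)
qed

text \<open>The midpoint inequality bounds \<open>c * (norm (y - z))\<^sup>2\<close> by the mean
  excess of \<open>\<Phi>\<close> over its infimum. Hence minimizing sequences are Cauchy,
  completeness gives a minimizer, and two minimizers coincide.\<close>

lemma strongly_midconvex_ex1_minimizer:
  fixes \<Phi> :: "'a::{real_normed_vector,complete_space} \<Rightarrow> real"
  assumes cont: "continuous_on UNIV \<Phi>" and "bdd_below (range \<Phi>)" and "c > 0"
    and mid: "\<And>y z. \<Phi> ((1/2) *\<^sub>R (y + z)) \<le> (\<Phi> y + \<Phi> z) / 2 - c * (norm (y - z))\<^sup>2"
  shows "\<exists>!z. \<forall>w. \<Phi> z \<le> \<Phi> w"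
proof -
  define m where "m = Inf (range \<Phi>)"
  have m: "m \<le> \<Phi> z" for z unfolding m_def by (rule cInf_lower) (use assms in auto)
  have close: "c * (norm (y - z))\<^sup>2 \<le> (\<Phi> y + \<Phi> z) / 2 - m" for y z
    using mid[of y z] m[of "(1/2) *\<^sub>R (y + z)"] by linarith
  have "\<exists>z. \<Phi> z < m + 1 / (real n + 1)" for n
    using cInf_lessD[of "range \<Phi>" "m + 1 / (real n + 1)"] by (auto simp: m_def)
  then obtain z where z: "\<And>n. \<Phi> (z n) < m + 1 / (real n + 1)" by metis
  have "Cauchy z"
  proof (rule metric_CauchyI)
    fix e :: real assume "e > 0"
    then have "c * e\<^sup>2 > 0" using \<open>c > 0\<close> by simp
    then obtain N where "inverse (real (Suc N)) < c * e\<^sup>2" using reals_Archimedean by blast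
    then have N: "1 / (real N + 1) < c * e\<^sup>2" by (simp add: inverse_eq_divide add.commute)
    have small: "\<Phi> (z n) < m + c * e\<^sup>2" if "n \<ge> N" for n
    proof -
      have "1 / (real n + 1) \<le> 1 / (real N + 1)" using that by (intro divide_left_mono) auto
      then show ?thesis using z[of n] N by linarith
    qed
    have "dist (z k) (z n) < e" if "k \<ge> N" "n \<ge> N" for k n
    proof -
      have "c * (norm (z k - z n))\<^sup>2 < c * e\<^sup>2"
        using close[of "z k" "z n"] small[OF that(1)] small[OF that(2)] by (simp add: field_simps)
      then have "(norm (z k - z n))\<^sup>2 < e\<^sup>2" using \<open>c > 0\<close> by simp
      then show ?thesis using \<open>e > 0\<close> by (simp add: dist_norm power_less_imp_less_base)
    qed
    then show "\<exists>N. \<forall>k\<ge>N. \<forall>n\<ge>N. dist (z k) (z n) < e" by blast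
  qed
  then obtain l where l: "z \<longlonglongrightarrow> l" using Cauchy_convergent convergent_def by blast
  have "(\<lambda>n. \<Phi> (z n)) \<longlonglongrightarrow> \<Phi> l"
    using cont l continuous_on_tendsto_compose[of UNIV \<Phi> z l] by auto
  moreover have "(\<lambda>n. m + 1 / (real n + 1)) \<longlonglongrightarrow> m + 0"
    using LIMSEQ_inverse_real_of_nat by (intro tendsto_add tendsto_const) (simp add: inverse_eq_divide add.commute)
  ultimately have "\<Phi> l \<le> m + 0"
    using z by (intro LIMSEQ_le[of "\<lambda>n. \<Phi> (z n)"]) (auto intro: less_imp_le)
  then have "\<forall>w. \<Phi> l \<le> \<Phi> w" using m order_trans by fastforce
  moreover have "y = y'" if "\<forall>w. \<Phi> y \<le> \<Phi> w" "\<forall>w. \<Phi> y' \<le> \<Phi> w" for y y'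
  proof -
    have "\<Phi> y = \<Phi> y'" using that by (simp add: antisym)
    moreover have "\<Phi> y \<le> \<Phi> ((1/2) *\<^sub>R (y + y'))" using that by blast
    ultimately have "c * (norm (y - y'))\<^sup>2 \<le> 0" using mid[of y y'] by simp
    then show ?thesis using \<open>c > 0\<close> by (simp add: mult_le_0_iff)
  qed
  ultimately show ?thesis by blast
qed

lemma Min_diff_eq_minus_Max:
  fixes a b :: "'m::finite \<Rightarrow> real"
  shows "Min (range (\<lambda>i. a i - b i)) = - Max (range (\<lambda>i. b i - a i))"
  by (subst minus_Max_eq_Min) (auto simp: image_image)

lemma Max_range_add_const:
  fixes a :: "'m::finite \<Rightarrow> real"
  shows "Max (range (\<lambda>i. a i + c)) = Max (range a) + c"
  using Max_add_commute[of "UNIV :: 'm set" a c] by simp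

text \<open>Negation turns the supremum of minima into an infimum of maxima, so any minimizer
  attains it. The competitor \<open>y\<close> itself contributes 0, whence the sign.\<close>

lemma merit_eq_at_argmin:
  fixes h :: "'m::finite \<Rightarrow> 'a \<Rightarrow> real"
  assumes z: "z \<in> argmin_set (\<lambda>z. Max (range (\<lambda>i. h i z - h i y)))"
  shows "merit h y = ereal (Min (range (\<lambda>i. h i y - h i z)))"
    and "0 \<le> Min (range (\<lambda>i. h i y - h i z))"
proof -
  have le: "Min (range (\<lambda>i. h i y - h i w)) \<le> Min (range (\<lambda>i. h i y - h i z))" for w
    using z unfolding Min_diff_eq_minus_Max argmin_set_def neg_le_iff_le by blast
  show "merit h y = ereal (Min (range (\<lambda>i. h i y - h i z)))"
    unfolding merit_def by (intro antisym SUP_least SUP_upper) (auto simp: le)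
  have "Min (range (\<lambda>i. h i y - h i y)) = 0" by simp
  then show "0 \<le> Min (range (\<lambda>i. h i y - h i z))" using le[of y] by (simp only:)
qed

locale convex_multiobjective =
  fixes f :: "'m::finite \<Rightarrow> 'a::{real_inner,complete_space} \<Rightarrow> real" and \<beta> p :: real
  assumes conv: "\<And>i. convex_on UNIV (f i)"
    and cont: "\<And>i. continuous_on UNIV (f i)"
    and \<beta>: "\<beta> > 0"
    and argmin_nonempty: "\<And>w. argmin_set (\<lambda>z. Max (range (\<lambda>i. f i z - w i))) \<noteq> {}"
begin

abbreviation gap :: "real \<Rightarrow> 'a \<Rightarrow> 'a \<Rightarrow> real" where
  "gap t y z \<equiv> Max (range (\<lambda>i. freg \<beta> p f t i z - freg \<beta> p f t i y))"

text \<open>The real value behind \<open>merit_t\<close>, so that estimates stay in the reals;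
  \<open>merit_t_eq\<close> is the link for positive \<open>t\<close>.\<close>

abbreviation merit_real :: "real \<Rightarrow> 'a \<Rightarrow> real" where
  "merit_real t y \<equiv> Min (range (\<lambda>i. freg \<beta> p f t i y - freg \<beta> p f t i (zpt \<beta> p f t y)))"

text \<open>The Tikhonov term is the same for every index, so it leaves the maximum.\<close>

lemma gap_eq:
  "gap t y z = Max (range (\<lambda>i. f i z - f i y)) + (\<beta> / (2 * t powr p) * (norm z)\<^sup>2 - \<beta> / (2 * t powr p) * (norm y)\<^sup>2)"
  unfolding Max_range_add_const[symmetric] freg_def by (simp add: algebra_simps)

text \<open>By the parallelogram law the midpoint loses a quarter of
  \<open>(norm (u - w))\<^sup>2\<close>, with coefficient \<open>\<beta> / (2 * t powr p)\<close>;
  hence the 8. Convexity at the index that is maximal at the midpoint does the rest.\<close>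

lemma gap_midpoint:
  "gap t y ((1/2) *\<^sub>R (u + w)) \<le> (gap t y u + gap t y w) / 2 - \<beta> / (8 * t powr p) * (norm (u - w))\<^sup>2"
proof -
  obtain i where i: "gap t y ((1/2) *\<^sub>R (u + w)) =
      freg \<beta> p f t i ((1/2) *\<^sub>R (u + w)) - freg \<beta> p f t i y" by (rule Max_range_attained)
  define c where "c = \<beta> / (8 * t powr p)"
  have c: "\<beta> / (2 * t powr p) = 4 * c" by (simp add: c_def)
  have nm: "(norm ((1/2) *\<^sub>R (u + w)))\<^sup>2 = ((norm u)\<^sup>2 + (norm w)\<^sup>2) / 2 - (norm (u - w))\<^sup>2 / 4"
    unfolding power2_norm_eq_inner by (simp add: algebra_simps inner_commute) (simp add: field_simps)
  have "f i ((1/2) *\<^sub>R (u + w)) \<le> (f i u + f i w) / 2"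
    using convex_onD[OF conv, of "1/2" u w i] by (simp add: scaleR_add_right)
  then have "freg \<beta> p f t i ((1/2) *\<^sub>R (u + w)) \<le>
      (freg \<beta> p f t i u + freg \<beta> p f t i w) / 2 - \<beta> / (8 * t powr p) * (norm (u - w))\<^sup>2"
    unfolding freg_def c c_def[symmetric] nm by argo
  moreover have "freg \<beta> p f t i u - freg \<beta> p f t i y \<le> gap t y u"
    "freg \<beta> p f t i w - freg \<beta> p f t i y \<le> gap t y w" by (rule Max_ge; simp)+
  ultimately show ?thesis unfolding i by argo
qed

text \<open>This makes the \<open>THE\<close> in \<open>zpt\<close> meaningful. Boundedness from
  below comes from a minimizer of the unregularized maximum, as the Tikhonov term at
  \<open>z\<close> only adds a nonnegative amount.\<close>

lemma zpt_argmin: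
  assumes "t > 0"
  shows "zpt \<beta> p f t y \<in> argmin_set (gap t y)"
proof -
  obtain z0 where z0: "\<And>z. Max (range (\<lambda>i. f i z0 - f i y)) \<le> Max (range (\<lambda>i. f i z - f i y))"
    using argmin_nonempty[of "\<lambda>i. f i y"] by (auto simp: argmin_set_def)
  have "\<exists>!z. \<forall>w. gap t y z \<le> gap t y w"
  proof (rule strongly_midconvex_ex1_minimizer)
    show "0 < \<beta> / (8 * t powr p)" using \<beta> assms by simp
    have "Max (range (\<lambda>i. f i z0 - f i y)) - \<beta> / (2 * t powr p) * (norm y)\<^sup>2 \<le> gap t y z" for z
    proof -
      have "0 \<le> \<beta> / (2 * t powr p) * (norm z)\<^sup>2" using \<beta> by simp
      then show ?thesis unfolding gap_eq using z0[of z] by linarith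
    qed
    then show "bdd_below (range (gap t y))" by (meson bdd_belowI2)
    have "continuous_on UNIV (\<lambda>z. Max ((\<lambda>i. freg \<beta> p f t i z - freg \<beta> p f t i y) ` S))"
      if "finite S" "S \<noteq> {}" for S
      using that
    proof (induction rule: finite_ne_induct)
      case (singleton i)
      show ?case using \<open>t > 0\<close> by (auto simp: freg_def intro!: continuous_intros cont)
    next
      case (insert i S)
      have "continuous_on UNIV (\<lambda>z. max (freg \<beta> p f t i z - freg \<beta> p f t i y)
          (Max ((\<lambda>i. freg \<beta> p f t i z - freg \<beta> p f t i y) ` S)))"
        by (intro continuous_on_max insert.IH) (use \<open>t > 0\<close> in \<open>auto simp: freg_def intro!: continuous_intros cont\<close>)
      then show ?case using insert by simp
    qed
    then show "continuous_on UNIV (gap t y)" by simp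
  qed (rule gap_midpoint)
  then show ?thesis unfolding zpt_def argmin_set_def mem_Collect_eq by (rule theI')
qed

lemma merit_t_eq:
  assumes "t > 0"
  shows "merit_t \<beta> p f t y = ereal (merit_real t y)" and "0 \<le> merit_real t y"
  unfolding merit_t_def by (rule merit_eq_at_argmin[OF zpt_argmin[OF assms]])+

text \<open>The minimizer is compared with the midpoint between it and \<open>y\<close>. This gives
  half the constant that strong convexity would give, which suffices for the signs below.\<close>

lemma merit_real_ge_norm_diff:
  assumes "t > 0"
  shows "\<beta> / (4 * t powr p) * (norm (y - zpt \<beta> p f t y))\<^sup>2 \<le> merit_real t y"
proof -
  let ?z = "zpt \<beta> p f t y"
  have "gap t y ?z \<le> gap t y ((1/2) *\<^sub>R (y + ?z))" using zpt_argmin[OF assms] by (simp add: argmin_set_def)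
  also have "\<dots> \<le> (gap t y y + gap t y ?z) / 2 - \<beta> / (8 * t powr p) * (norm (y - ?z))\<^sup>2"
    by (rule gap_midpoint)
  finally have "gap t y ?z \<le> gap t y y / 2 + gap t y ?z / 2 - \<beta> / (8 * t powr p) * (norm (y - ?z))\<^sup>2"
    by (simp only: add_divide_distrib)
  moreover have "gap t y y = 0" by simp
  moreover have "\<beta> / (4 * t powr p) * (norm (y - ?z))\<^sup>2 = 2 * (\<beta> / (8 * t powr p) * (norm (y - ?z))\<^sup>2)" by simp
  ultimately show ?thesis unfolding Min_diff_eq_minus_Max by linarith
qed

text \<open>With the regularization \<open>zpt\<close> is at least as good, without it
  \<open>z0\<close> is; the two Tikhonov terms must then be ordered in this way.\<close>

lemma norm_zpt_le:
  assumes "t > 0" and z0: "z0 \<in> argmin_set (\<lambda>z. Max (range (\<lambda>i. f i z - f i y)))"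
  shows "norm (zpt \<beta> p f t y) \<le> norm z0"
proof -
  let ?z = "zpt \<beta> p f t y"
  have "gap t y ?z \<le> gap t y z0" using zpt_argmin[OF assms(1)] by (simp add: argmin_set_def)
  moreover have "Max (range (\<lambda>i. f i z0 - f i y)) \<le> Max (range (\<lambda>i. f i ?z - f i y))"
    using z0 by (simp add: argmin_set_def)
  ultimately have "\<beta> / (2 * t powr p) * (norm ?z)\<^sup>2 \<le> \<beta> / (2 * t powr p) * (norm z0)\<^sup>2"
    unfolding gap_eq by linarith
  then have "(norm ?z)\<^sup>2 \<le> (norm z0)\<^sup>2" using \<beta> assms(1) by (simp add: divide_le_cancel)
  then show ?thesis by (simp add: power2_le_iff_abs_le)
qed

text \<open>Using \<open>z0\<close> as a competitor in the regularized problem costs only its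
  Tikhonov term. This term later sets the rate of the plain merit.\<close>

lemma merit_le_merit_real:
  assumes "t > 0" and z0: "z0 \<in> argmin_set (\<lambda>z. Max (range (\<lambda>i. f i z - f i y)))"
  obtains m where "merit f y = ereal m" "0 \<le> m" "m \<le> merit_real t y + \<beta> / (2 * t powr p) * (norm z0)\<^sup>2"
proof (rule that)
  show "merit f y = ereal (Min (range (\<lambda>i. f i y - f i z0)))" "0 \<le> Min (range (\<lambda>i. f i y - f i z0))"
    using merit_eq_at_argmin[OF z0] .
  have "gap t y (zpt \<beta> p f t y) \<le> gap t y z0" using zpt_argmin[OF assms(1)] by (simp add: argmin_set_def)
  moreover have "0 \<le> \<beta> / (2 * t powr p) * (norm y)\<^sup>2" using \<beta> by simp
  ultimately show "Min (range (\<lambda>i. f i y - f i z0)) \<le> merit_real t y + \<beta> / (2 * t powr p) * (norm z0)\<^sup>2"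
    unfolding Min_diff_eq_minus_Max gap_eq[of t z0 y] by linarith
qed

end

section \<open>Trajectories\<close>

text \<open>The hull of finitely many points is compact and convex, so the \<open>THE\<close> in
  \<open>proj\<close> denotes the element of least norm. Its obtuse angle inequality is the second
  claim.\<close>

lemma proj_zero_convex_hull:
  fixes e :: "'a::real_inner"
  assumes "finite F" "F \<noteq> {}"
  defines "S \<equiv> (\<lambda>c. c + e) ` (convex hull F)"
  shows "proj S 0 \<in> S" and "w \<in> S \<Longrightarrow> (norm (proj S 0))\<^sup>2 \<le> proj S 0 \<bullet> w"
proof -
  have "compact S" unfolding S_def
    by (intro compact_continuous_image finite_imp_compact_convex_hull assms continuous_intros)
  moreover have "S \<noteq> {}" using assms by (simp add: S_def)
  moreover have "continuous_on S (\<lambda>w. dist 0 w)" by (intro continuous_intros)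
  ultimately have "\<exists>s\<in>S. \<forall>w\<in>S. dist 0 s \<le> dist 0 w"
    by (rule continuous_attains_inf)
  then obtain s where s: "s \<in> S" "\<forall>w\<in>S. dist 0 s \<le> dist 0 w" by blast
  have "convex S" unfolding S_def
    using convex_translation[OF convex_convex_hull, of e F] by (simp add: add.commute)
  have "closed S" using \<open>compact S\<close> by (rule compact_imp_closed)
  have "proj S 0 = s" unfolding proj_def
  proof (rule the_equality)
    show "s \<in> S \<and> (\<forall>w\<in>S. dist 0 s \<le> dist 0 w)" using s by blast
    show "z = s" if "z \<in> S \<and> (\<forall>w\<in>S. dist 0 z \<le> dist 0 w)" for z
      using that s by (intro any_closest_point_unique[OF \<open>convex S\<close> \<open>closed S\<close>, of z s 0]) blast+
  qed
  then show "proj S 0 \<in> S" using s by simp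
  assume "w \<in> S"
  have "inner (0 - s) (w - s) \<le> 0"
    by (rule any_closest_point_dot[OF \<open>convex S\<close> \<open>closed S\<close> s(1) \<open>w \<in> S\<close> s(2)])
  then show "(norm (proj S 0))\<^sup>2 \<le> proj S 0 \<bullet> w"
    using \<open>proj S 0 = s\<close> by (simp add: power2_norm_eq_inner inner_diff_right)
qed

lemma has_real_derivative_inner:
  fixes a b :: "real \<Rightarrow> 'a::real_inner"
  assumes "(a has_vector_derivative a') (at t)" "(b has_vector_derivative b') (at t)"
  shows "((\<lambda>t. a t \<bullet> b t) has_real_derivative a t \<bullet> b' + a' \<bullet> b t) (at t)"
  unfolding has_real_derivative_iff_has_vector_derivative
  by (rule bounded_bilinear.has_vector_derivative[OF bounded_bilinear_inner assms])

lemma has_real_derivative_powr_div: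
  fixes t c :: real
  assumes "t > 0"
  shows "((\<lambda>t. t powr c) has_real_derivative c * (t powr c) / t) (at t)"
  using has_real_derivative_powr[OF assms, of c] assms by (simp add: powr_diff)

lemma inc_dominated_real_C1:
  fixes h :: "real \<Rightarrow> real"
  assumes "\<And>t. t \<in> {a..b} \<Longrightarrow> (h has_real_derivative h' t) (at t)"
    and "continuous_on {a..b} h'"
  shows "inc_dominated {a..b} v h"
proof (rule inc_dominated_C1[OF _ assms(2)])
  fix t assume "t \<in> {a..b}"
  then show "(h has_vector_derivative h' t) (at t within {a..b})"
    using assms(1) has_vector_derivative_at_within
    unfolding has_real_derivative_iff_has_vector_derivative by blast
qed

section \<open>Trajectory solutions: variational form and a priori bounds\<close>

locale mtrigs = convex_multiobjective f \<beta> p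
  for f :: "'m::finite \<Rightarrow> 'a::{real_inner,complete_space} \<Rightarrow> real" and \<beta> p :: real +
  fixes g :: "'m \<Rightarrow> 'a \<Rightarrow> 'a" and x v acc :: "real \<Rightarrow> 'a" and x0 v0 :: 'a and t0 \<alpha> q :: real
  assumes grad: "\<And>i y. (f i has_derivative (\<lambda>h. g i y \<bullet> h)) (at y)"
    and grad_cont: "\<And>i. continuous_on UNIV (g i)"
    and t0: "t0 > 0" and \<alpha>: "\<alpha> > 0" and q: "0 < q" "q < 1" and p: "0 < p" "p < q + 1"
    and A3: "A3 f \<beta> p t0 x0 v0"
    and sol: "MTRIGS_solution g t0 \<alpha> \<beta> q p x0 v0 x v acc"
begin

lemma x_deriv_within: "t \<ge> t0 \<Longrightarrow> (x has_vector_derivative v t) (at t within {t0..})"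
  and v_cont: "continuous_on {t0..} v"
  and v_ac: "T \<ge> t0 \<Longrightarrow> abs_cont_on {t0..T} v"
  and initial: "x t0 = x0" "v t0 = v0"
  using sol by (simp_all add: MTRIGS_solution_def)

lemma x_deriv: "t > t0 \<Longrightarrow> (x has_vector_derivative v t) (at t)"
  using x_deriv_within[of t] at_within_interior[of t "{t0..}"] by simp

lemma x_cont: "continuous_on {t0..} x"
  using x_deriv_within by (intro continuous_on_vector_derivative) auto

lemma v_ac_subinterval: "t0 \<le> a \<Longrightarrow> abs_cont_on {a..b} v"
  using abs_cont_on_subset[OF v_ac[of "max a b"], of "{a..b}"] by auto

lemma fx_deriv: "t > t0 \<Longrightarrow> ((\<lambda>t. f i (x t)) has_real_derivative g i (x t) \<bullet> v t) (at t)"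
  using has_derivative_compose[OF x_deriv[unfolded has_vector_derivative_def] grad, of t i]
  by (simp add: has_field_derivative_def mult_commute_abs)

lemma v_bounded: "t0 \<le> a \<Longrightarrow> bounded (v ` {a..b})"
  by (intro compact_imp_bounded compact_continuous_image continuous_on_subset[OF v_cont]) auto

lemmas dom_inner = bounded_bilinear.inc_dominated[OF bounded_bilinear_inner _ _ bounded_closed_interval v_bounded]
lemmas dom_mult = bounded_bilinear.inc_dominated[OF bounded_bilinear_mult _ _ bounded_closed_interval v_bounded]

lemma dom_const: "inc_dominated {a..b} v (\<lambda>t. c)"
  by (auto simp: inc_dominated_def intro: exI[of _ 0])

lemma dom_x: "t0 \<le> a \<Longrightarrow> inc_dominated {a..b} v x"
proof (rule inc_dominated_C1[where h' = v])
  assume a: "t0 \<le> a"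
  then show "continuous_on {a..b} v" by (intro continuous_on_subset[OF v_cont]) auto
  show "(x has_vector_derivative v t) (at t within {a..b})" if "t \<in> {a..b}" for t
    using a that by (intro has_vector_derivative_within_subset[OF x_deriv_within]) auto
qed

lemma dom_x_diff: "t0 \<le> a \<Longrightarrow> inc_dominated {a..b} v (\<lambda>t. x t - z)"
  using inc_dominated_add[OF dom_x dom_const, of a b "- z"] by simp

lemma dom_fx: "t0 \<le> a \<Longrightarrow> inc_dominated {a..b} v (\<lambda>t. f i (x t))"
proof (rule inc_dominated_C1[where h' = "\<lambda>t. g i (x t) \<bullet> v t"])
  assume a: "t0 \<le> a"
  have sub: "{a..b} \<subseteq> {t0..}" using a by auto
  show "continuous_on {a..b} (\<lambda>t. g i (x t) \<bullet> v t)"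
    by (intro continuous_intros continuous_on_subset[OF v_cont sub]
        continuous_on_compose2[OF grad_cont continuous_on_subset[OF x_cont sub]]) auto
  show "((\<lambda>t. f i (x t)) has_vector_derivative g i (x t) \<bullet> v t) (at t within {a..b})" if "t \<in> {a..b}" for t
  proof -
    have "(x has_vector_derivative v t) (at t within {a..b})"
      using a that by (intro has_vector_derivative_within_subset[OF x_deriv_within]) auto
    from has_derivative_compose[OF this[unfolded has_vector_derivative_def] grad]
    show ?thesis by (simp add: has_vector_derivative_def)
  qed
qed

lemma dom_powr: "t0 \<le> a \<Longrightarrow> inc_dominated {a..b} v (\<lambda>t. t powr c)"
  using t0 by (intro inc_dominated_real_C1[where h' = "\<lambda>t. c * (t powr c) / t"] has_real_derivative_powr_div)
    (auto intro!: continuous_intros)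

text \<open>The equation makes \<open>- (\<alpha> / t powr q) v\<close> the element of least norm of
  the shifted hull. Membership expresses the acceleration through some \<open>\<xi>\<close> in the
  hull; minimality gives an inequality for every index, after division by the damping coefficient.
  One null set serves all indices.\<close>

lemma variational:
  obtains N where "negligible N"
    and "\<And>t. t \<ge> t0 \<Longrightarrow> t \<notin> N \<Longrightarrow> t > t0"
    and "\<And>t. t \<ge> t0 \<Longrightarrow> t \<notin> N \<Longrightarrow> (v has_vector_derivative acc t) (at t)"
    and "\<And>t. t \<ge> t0 \<Longrightarrow> t \<notin> N \<Longrightarrow> \<exists>\<xi> \<in> convex hull (range (\<lambda>i. g i (x t))).
          acc t = - ((\<alpha> / t powr q) *\<^sub>R v t) - \<xi> - (\<beta> / t powr p) *\<^sub>R x t"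
    and "\<And>t i. t \<ge> t0 \<Longrightarrow> t \<notin> N \<Longrightarrow>
          g i (x t) \<bullet> v t + \<beta> / t powr p * (x t \<bullet> v t) + acc t \<bullet> v t \<le> - (\<alpha> / t powr q) * (v t \<bullet> v t)"
proof -
  let ?S = "\<lambda>t. (\<lambda>c. c + (\<beta> / t powr p) *\<^sub>R x t + acc t) ` (convex hull (range (\<lambda>i. g i (x t))))"
  define P where "P t \<longleftrightarrow> (t \<ge> t0 \<longrightarrow> (v has_vector_derivative acc t) (at t) \<and>
      (\<alpha> / t powr q) *\<^sub>R v t + proj (?S t) 0 = 0)" for t
  have "AE t in lebesgue. P t"
  proof -
    have "AE t in lebesgue. t \<ge> t0 \<longrightarrow> (v has_vector_derivative acc t) (at t)"
      "AE t in lebesgue. t \<ge> t0 \<longrightarrow> (\<alpha> / t powr q) *\<^sub>R v t + proj (?S t) 0 = 0"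
      using sol unfolding MTRIGS_solution_def by blast+
    then show ?thesis by eventually_elim (simp add: P_def)
  qed
  then obtain M where "{t \<in> space lebesgue. \<not> P t} \<subseteq> M" "emeasure lebesgue M = 0" "M \<in> sets lebesgue"
    by (rule AE_E)
  then have M: "negligible M" "\<And>t. t \<notin> M \<Longrightarrow> P t"
    by (auto simp: negligible_iff_null_sets intro: null_setsI)
  \<comment> \<open>Only a one-sided derivative of \<open>x\<close> is given at \<open>t0\<close>,
    so this point joins the null set.\<close>
  show thesis
  proof (rule that[of "insert t0 M"])
    show "negligible (insert t0 M)" using M(1) by simp
    fix t assume t: "t \<ge> t0" "t \<notin> insert t0 M"
    then show "t > t0" by auto
    have "P t" using M t by auto
    then show "(v has_vector_derivative acc t) (at t)" using t by (simp add: P_def)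
    define k where "k = \<alpha> / t powr q"
    have "k > 0" using \<alpha> t0 t by (simp add: k_def)
    have S: "?S t = (\<lambda>c. c + ((\<beta> / t powr p) *\<^sub>R x t + acc t)) ` (convex hull (range (\<lambda>i. g i (x t))))"
      by (simp add: add.assoc)
    have pr: "proj (?S t) 0 = - (k *\<^sub>R v t)"
      using \<open>P t\<close> t unfolding P_def k_def by (metis add_eq_0_iff)
    have "- (k *\<^sub>R v t) \<in> ?S t"
      using proj_zero_convex_hull(1)[of "range (\<lambda>i. g i (x t))"] unfolding pr[symmetric] S by simp
    then obtain \<xi> where "\<xi> \<in> convex hull (range (\<lambda>i. g i (x t)))"
      "- (k *\<^sub>R v t) = \<xi> + (\<beta> / t powr p) *\<^sub>R x t + acc t" by blast
    moreover from this(2) have "acc t = - (k *\<^sub>R v t) - \<xi> - (\<beta> / t powr p) *\<^sub>R x t"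
      by (simp add: algebra_simps)
    ultimately show "\<exists>\<xi> \<in> convex hull (range (\<lambda>i. g i (x t))).
          acc t = - ((\<alpha> / t powr q) *\<^sub>R v t) - \<xi> - (\<beta> / t powr p) *\<^sub>R x t"
      unfolding k_def by blast
    fix i
    define w where "w = g i (x t) + (\<beta> / t powr p) *\<^sub>R x t + acc t"
    have "g i (x t) \<in> convex hull (range (\<lambda>i. g i (x t)))" by (intro hull_inc) simp
    then have "w \<in> ?S t" unfolding w_def by blast
    then have "(norm (proj (?S t) 0))\<^sup>2 \<le> proj (?S t) 0 \<bullet> w"
      using proj_zero_convex_hull(2)[of "range (\<lambda>i. g i (x t))" w] unfolding S by simp
    then have "k * (k * (v t \<bullet> v t)) \<le> k * (- (v t \<bullet> w))"
      unfolding pr power2_norm_eq_inner by simp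
    then have "k * (v t \<bullet> v t) \<le> - (v t \<bullet> w)"
      using \<open>k > 0\<close> by (simp only: mult_le_cancel_left_pos)
    then show "g i (x t) \<bullet> v t + \<beta> / t powr p * (x t \<bullet> v t) + acc t \<bullet> v t \<le> - (\<alpha> / t powr q) * (v t \<bullet> v t)"
      unfolding w_def k_def[symmetric] by (simp add: inner_add_right inner_commute)
  qed
qed

text \<open>The derivative is nonpositive for every index by the variational inequality, and the
  decreasing Tikhonov coefficient helps. The initial value is the level in (A3), so the whole
  trajectory stays in that level set.\<close>

lemma component_energy_antimono:
  assumes "t \<ge> t0"
  shows "freg \<beta> p f t i (x t) + (norm (v t))\<^sup>2 / 2 \<le> freg \<beta> p f t0 i x0 + (norm v0)\<^sup>2 / 2"
proof -
  define H where "H s = f i (x s) + (\<beta> / 2) * (s powr (-p) * (x s \<bullet> x s)) + (1/2) * (v s \<bullet> v s)" for s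
  have H: "H s = freg \<beta> p f s i (x s) + (norm (v s))\<^sup>2 / 2" for s
    by (simp add: H_def freg_def power2_norm_eq_inner powr_minus divide_simps)
  obtain N where N: "negligible N"
    and t0N: "\<And>t. t \<ge> t0 \<Longrightarrow> t \<notin> N \<Longrightarrow> t > t0"
    and v': "\<And>t. t \<ge> t0 \<Longrightarrow> t \<notin> N \<Longrightarrow> (v has_vector_derivative acc t) (at t)"
    and var: "\<And>t i. t \<ge> t0 \<Longrightarrow> t \<notin> N \<Longrightarrow>
          g i (x t) \<bullet> v t + \<beta> / t powr p * (x t \<bullet> v t) + acc t \<bullet> v t \<le> - (\<alpha> / t powr q) * (v t \<bullet> v t)"
    using variational by metis
  define D where "D s = g i (x s) \<bullet> v s + (\<beta> / 2) * (- p * (s powr (-p)) / s * (x s \<bullet> x s) +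
      (2 * (x s \<bullet> v s)) * s powr (-p)) + (1/2) * (2 * (acc s \<bullet> v s))" for s
  \<comment> \<open>A constant family reduces the claim about one function to the lemma on
    minima.\<close>
  have "Min (range (\<lambda>_::'m. H t)) \<le> Min (range (\<lambda>_::'m. H t0))"
  proof (rule Min_antimono_if_active_deriv_nonpos[where D = "\<lambda>_. D", OF assms v_ac_subinterval _ N])
    show "inc_dominated {t0..t} v H" unfolding H_def
      by (intro inc_dominated_add dom_mult dom_inner dom_const dom_fx dom_powr dom_x inc_dominated_self) auto
    fix s assume "s \<in> {t0..t} - N"
    then have s: "s \<ge> t0" "s \<notin> N" "s > t0" using t0N by auto
    then have "s > 0" using t0 by simp
    have "((\<lambda>s. x s \<bullet> x s) has_real_derivative 2 * (x s \<bullet> v s)) (at s)"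
      using has_real_derivative_inner[OF x_deriv x_deriv, OF s(3) s(3)] by (simp add: inner_commute)
    moreover have "((\<lambda>s. v s \<bullet> v s) has_real_derivative 2 * (acc s \<bullet> v s)) (at s)"
      using has_real_derivative_inner[OF v' v', OF s(1,2) s(1,2)] by (simp add: inner_commute)
    ultimately show "(H has_real_derivative D s) (at s)"
      unfolding H_def D_def
      by (intro DERIV_add DERIV_cmult DERIV_mult fx_deriv s has_real_derivative_powr_div \<open>s > 0\<close>)
    have "D s = (g i (x s) \<bullet> v s + \<beta> / s powr p * (x s \<bullet> v s) + acc s \<bullet> v s)
        - \<beta> / 2 * p * (s powr (-p) / s * (x s \<bullet> x s))"
      unfolding D_def by (simp add: powr_minus field_simps)
    also have "\<dots> \<le> 0 - 0"
    proof (intro diff_mono)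
      have "0 \<le> (\<alpha> / s powr q) * (v s \<bullet> v s)" using \<alpha> by simp
      then show "g i (x s) \<bullet> v s + \<beta> / s powr p * (x s \<bullet> v s) + acc s \<bullet> v s \<le> 0"
        using var[OF s(1,2), of i] by linarith
      show "0 \<le> \<beta> / 2 * p * (s powr (-p) / s * (x s \<bullet> x s))" using \<beta> p \<open>s > 0\<close> by simp
    qed
    finally show "D s \<le> 0" by simp
  qed auto
  then show ?thesis using H[of t] H[of t0] initial by simp
qed

lemma argmin_bounded:
  obtains R where "R > 0" and "\<And>t. t \<ge> t0 \<Longrightarrow>
    \<exists>z0 \<in> argmin_set (\<lambda>z. Max (range (\<lambda>i. f i z - f i (x t)))). norm z0 \<le> R"
proof -
  define b where "b i = f i x0 + (\<beta> / (2 * t0 powr p) * (norm x0)\<^sup>2 + (norm v0)\<^sup>2 / 2)" for i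
  obtain R where R: "\<And>y. y \<in> LPw f b \<Longrightarrow> (INF z \<in> {z. \<forall>i. f i z = f i y}. norm z) \<le> R"
    using A3 unfolding A3_def Let_def b_def by blast
  show thesis
  \<comment> \<open>(A3) bounds an infimum of norms, which need not be attained; the extra 1 leaves
    room for an actual point.\<close>
  proof (rule that[of "\<bar>R\<bar> + 1"])
    show "0 < \<bar>R\<bar> + 1" by simp
    fix t assume t: "t \<ge> t0"
    let ?M = "\<lambda>z. Max (range (\<lambda>i. f i z - f i (x t)))"
    have xb: "f i (x t) \<le> b i" for i
    proof -
      have "0 \<le> \<beta> / (2 * t powr p) * (norm (x t))\<^sup>2" using \<beta> by simp
      then show ?thesis using component_energy_antimono[OF t, of i] unfolding b_def freg_def
        using zero_le_power2[of "norm (v t)"] by linarith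
    qed
    \<comment> \<open>A minimizer of \<open>?M\<close> is weakly Pareto optimal, and membership in the set of minimizers
      depends only on the objective values, so (A3) replaces it by one of bounded norm.\<close>
    obtain y where y: "\<And>w. ?M y \<le> ?M w"
      using argmin_nonempty[of "\<lambda>i. f i (x t)"] by (auto simp: argmin_set_def)
    have "f i y \<le> b i" for i
    proof -
      have "f i y - f i (x t) \<le> ?M y" by (rule Max_ge) auto
      also have "\<dots> \<le> ?M (x t)" by (rule y)
      finally show ?thesis using xb[of i] by simp
    qed
    moreover have "y \<in> weak_pareto f"
    proof (rule ccontr)
      assume "y \<notin> weak_pareto f"
      then obtain w where w: "\<And>i. f i w < f i y" by (auto simp: weak_pareto_def)
      obtain i where "?M w = f i w - f i (x t)" by (rule Max_range_attained)
      also have "\<dots> < f i y - f i (x t)" using w by simp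
      also have "\<dots> \<le> ?M y" by (rule Max_ge) auto
      finally show False using y[of w] by linarith
    qed
    ultimately have "y \<in> LPw f b" by (simp add: LPw_def level_set_def)
    then have "(INF z \<in> {z. \<forall>i. f i z = f i y}. norm z) < \<bar>R\<bar> + 1" using R[of y] by linarith
    then obtain z0 where z0: "\<forall>i. f i z0 = f i y" "norm z0 < \<bar>R\<bar> + 1"
      using cInf_lessD[of "norm ` {z. \<forall>i. f i z = f i y}"] by auto
    have "?M z0 = ?M y" using z0(1) by simp
    then have "z0 \<in> argmin_set ?M" unfolding argmin_set_def using y by (simp only: mem_Collect_eq) blast
    then show "\<exists>z0 \<in> argmin_set ?M. norm z0 \<le> \<bar>R\<bar> + 1" using z0(2) by (intro bexI[of _ z0]) auto
  qed
qed

end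

section \<open>The Lyapunov function for a frozen reference point\<close>

text \<open>The derivative of the bracket plus \<open>\<theta>'\<close> times the bracket, as an inequality between numbers:
  \<open>A, Q, B, D, \<tau>\<close> stand for the powers of \<open>t\<close> with exponents \<open>-r, -q, -p, r-p-1, -1\<close>.\<close>

lemma lyapunov_dissipation:
  fixes A Q B D \<tau> K V Y X xx zz xv gv av ya mi \<alpha> \<beta> p q r lam :: real
  assumes pos: "A \<ge> 0" "Q \<ge> 0" "B \<ge> 0" "\<tau> \<ge> 0" "V \<ge> 0" "X \<ge> 0" "xx \<ge> 0" "K \<ge> 0"
    and par: "\<alpha> > 0" "\<beta> > 0" "p > 0" "q > 0" "r > 0" "lam > 0" "lam \<le> 2 * \<alpha> / 3" "lam \<le> \<beta> / \<alpha>"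
    and h1: "gv + \<beta> * B * xv + av \<le> - (\<alpha> * Q * V)"
    and h2: "ya \<le> - (\<alpha> * Q * Y) - mi - \<beta> / 2 * B * X"
    and AQ: "A \<le> Q" and AQB: "A * Q \<le> B" and rA: "3 * r * \<tau> \<le> lam * A"
    and AD: "A * D = B * \<tau>" and DB: "2 * (p + 1 - r) * D \<le> lam * B" and K: "p * \<beta> * zz \<le> K * lam"
  defines "\<kappa> \<equiv> r * A * \<tau> + \<alpha> * A * Q - lam * A\<^sup>2"
    and "\<kappa>' \<equiv> - (r * (r + 1) * A * \<tau>\<^sup>2) - \<alpha> * (r + q) * A * Q * \<tau> + 2 * r * lam * A\<^sup>2 * \<tau>"
  shows "(gv + \<beta> / 2 * (- (p * B * \<tau>) * (xx - zz) + 2 * B * xv) + av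
     + lam * (- (r * A * \<tau>) * Y + A * (V + ya)) + lam / 2 * (\<kappa>' * X + 2 * \<kappa> * Y) - K * ((r - p - 1) * D * \<tau>))
     + lam * A * (mi + V / 2 + lam * A * Y + lam / 2 * \<kappa> * X - K * D) \<le> 0"
proof -
  \<comment> \<open>The grouping isolates \<open>h1\<close>, \<open>h2\<close> and the coefficients
    of \<open>V\<close> and \<open>X\<close>, so that each can be given its sign separately.\<close>
  have "(gv + \<beta> / 2 * (- (p * B * \<tau>) * (xx - zz) + 2 * B * xv) + av
     + lam * (- (r * A * \<tau>) * Y + A * (V + ya)) + lam / 2 * (\<kappa>' * X + 2 * \<kappa> * Y) - K * ((r - p - 1) * D * \<tau>))
     + lam * A * (mi + V / 2 + lam * A * Y + lam / 2 * \<kappa> * X - K * D)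
    = (gv + \<beta> * B * xv + av + \<alpha> * Q * V) + lam * A * (ya + \<alpha> * Q * Y + mi + \<beta> / 2 * B * X)
     + V * (3 / 2 * lam * A - \<alpha> * Q)
     + lam / 2 * X * (\<kappa>' + lam * A * \<kappa> - \<beta> * A * B)
     - p * \<beta> / 2 * B * \<tau> * xx + p * \<beta> * zz / 2 * (B * \<tau>) + K * \<tau> * ((p + 1 - r) * D) - K * lam * (A * D)"
    unfolding \<kappa>_def by (simp add: algebra_simps power2_eq_square)
  also have "\<dots> \<le> 0"
  proof -
    have "lam * A * (ya + \<alpha> * Q * Y + mi + \<beta> / 2 * B * X) \<le> 0"
      using h2 par pos by (intro mult_nonneg_nonpos) auto
    moreover have "V * (3 / 2 * lam * A - \<alpha> * Q) \<le> 0"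
    proof -
      \<comment> \<open>The cross term contributes \<open>lam * A * V\<close> and the weight half as
        much; this is the origin of \<open>lam \<le> 2 * \<alpha> / 3\<close>.\<close>
      have "(3 / 2 * lam) * A \<le> \<alpha> * Q" using par pos AQ by (intro mult_mono) auto
      then show ?thesis using pos by (intro mult_nonneg_nonpos) auto
    qed
    moreover have "lam / 2 * X * (\<kappa>' + lam * A * \<kappa> - \<beta> * A * B) \<le> 0"
    proof -
      \<comment> \<open>The part without \<open>\<tau>\<close> sets
        \<open>lam * \<alpha> * A * A * Q\<close> against \<open>\<beta> * A * B\<close>, whence
        \<open>lam \<le> \<beta> / \<alpha>\<close>. The positive terms with \<open>\<tau>\<close>
        total \<open>3 * r * lam * A\<^sup>2 * \<tau>\<close> and are absorbed by
        \<open>lam\<^sup>2 * A ^ 3\<close>.\<close>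
      have "lam * \<alpha> * (A * Q) \<le> \<beta> * B"
        using par pos AQB by (intro mult_mono) (auto simp: field_simps)
      then have a: "A * (lam * \<alpha> * (A * Q)) \<le> A * (\<beta> * B)" using pos by (intro mult_left_mono)
      have b: "lam * A\<^sup>2 * (3 * r * \<tau>) \<le> lam * A\<^sup>2 * (lam * A)" using par pos rA by (intro mult_left_mono) auto
      have c: "0 \<le> r * (r + 1) * A * \<tau>\<^sup>2" "0 \<le> \<alpha> * (r + q) * A * Q * \<tau>" using par pos by simp_all
      have "\<kappa>' + lam * A * \<kappa> - \<beta> * A * B = (A * (lam * \<alpha> * (A * Q)) - A * (\<beta> * B))
          + (lam * A\<^sup>2 * (3 * r * \<tau>) - lam * A\<^sup>2 * (lam * A))
          - r * (r + 1) * A * \<tau>\<^sup>2 - \<alpha> * (r + q) * A * Q * \<tau>"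
        unfolding \<kappa>_def \<kappa>'_def by (simp add: algebra_simps power2_eq_square)
      also have "\<dots> \<le> 0" using a b c by linarith
      finally show ?thesis using par pos by (intro mult_nonneg_nonpos) auto
    qed
    moreover have "0 \<le> p * \<beta> / 2 * B * \<tau> * xx" using par pos by simp
    moreover have "p * \<beta> * zz / 2 * (B * \<tau>) + K * \<tau> * ((p + 1 - r) * D) - K * lam * (A * D) \<le> 0"
    proof -
      have "p * \<beta> * zz * (B * \<tau>) \<le> K * lam * (B * \<tau>)" using K pos by (intro mult_right_mono) auto
      moreover have "K * \<tau> * (2 * (p + 1 - r) * D) \<le> K * \<tau> * (lam * B)" using DB pos by (intro mult_left_mono) auto
      ultimately show ?thesis unfolding AD by (simp add: algebra_simps)
    qed
    ultimately show ?thesis using h1 by linarith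
  qed
  finally show ?thesis .
qed
locale mtrigs_lyapunov = mtrigs f \<beta> p g x v acc x0 v0 t0 \<alpha> q
  for f :: "'m::finite \<Rightarrow> 'a::{real_inner,complete_space} \<Rightarrow> real"
    and \<beta> p g x v acc x0 v0 t0 \<alpha> q +
  fixes r lam :: real
  assumes r: "q \<le> r" "p - q \<le> r" "r < 1"
    and lam: "0 < lam" "lam \<le> 2 * \<alpha> / 3" "lam \<le> \<beta> / \<alpha>"
begin

text \<open>The factor \<open>t\<^sup>-\<^sup>2\<^sup>r (r t\<^sup>r\<^sup>-\<^sup>1 + \<alpha> t\<^sup>r\<^sup>-\<^sup>q - lam)\<close>: the coefficient in the energy plus the \<open>lam\<close> that
  comes from expanding the square.  With it, all terms in \<open>(x - z) \<bullet> v\<close> cancel in the derivative.\<close>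

definition kappa :: "real \<Rightarrow> real" where
  "kappa t = r * (t powr (-r) / t) + \<alpha> * (t powr (-r) * t powr (-q)) - lam * (t powr (-r))\<^sup>2"

text \<open>Squared norms are written as inner products so that the bilinear rules for derivatives
  and for dominated increments apply summand by summand. The index enters only through
  \<open>f i (x t) - f i z\<close>, which therefore decides which indices are active.\<close>

definition lyap :: "real \<Rightarrow> 'a \<Rightarrow> 'm \<Rightarrow> real \<Rightarrow> real" where
  "lyap K z i t = (f i (x t) - f i z + \<beta> / 2 * (t powr (-p) * (x t \<bullet> x t - z \<bullet> z)))
     + (1/2 * (v t \<bullet> v t) + lam * (t powr (-r) * ((x t - z) \<bullet> v t))
     + lam / 2 * (kappa t * ((x t - z) \<bullet> (x t - z))) - K * t powr (r - p - 1))"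

definition weight :: "real \<Rightarrow> real" where
  "weight t = exp (lam / (1 - r) * t powr (1 - r))"

text \<open>Because \<open>r < 1\<close>, the damping \<open>lam t^(-r)\<close> eventually outweighs
  any multiple of \<open>1/t\<close>. The threshold involves neither \<open>z\<close> nor
  \<open>K\<close>.\<close>

lemma eventually_large:
  "\<forall>\<^sub>F t in at_top. t > t0 \<and> t \<ge> 1 \<and> 3 * r \<le> lam * t powr (1 - r) \<and> 2 * (p + 1 - r) \<le> lam * t powr (1 - r)"
proof -
  have "filterlim (\<lambda>t. lam * t powr (1 - r)) at_top at_top"
    using lam(1) r(3) by real_asymp
  then have "\<forall>\<^sub>F t in at_top. 3 * r \<le> lam * t powr (1 - r)" "\<forall>\<^sub>F t in at_top. 2 * (p + 1 - r) \<le> lam * t powr (1 - r)"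
    by (auto simp: filterlim_at_top)
  then show ?thesis using eventually_gt_at_top[of t0] eventually_ge_at_top[of 1]
    by eventually_elim simp
qed

lemma r_pos: "0 < r"
  using q r by linarith

lemma kappa_deriv:
  assumes "t > 0"
  shows "(kappa has_real_derivative - (r * (r + 1) * t powr (-r) * (1/t)\<^sup>2)
     - \<alpha> * (r + q) * t powr (-r) * t powr (-q) * (1/t) + 2 * r * lam * (t powr (-r))\<^sup>2 * (1/t)) (at t)"
proof -
  note P = has_real_derivative_powr_div[OF assms]
  show ?thesis unfolding kappa_def
    by (rule DERIV_cong[OF DERIV_diff[OF DERIV_add[OF DERIV_cmult[OF DERIV_divide[OF P DERIV_ident]]
          DERIV_cmult[OF DERIV_mult[OF P P]]] DERIV_cmult[OF DERIV_power[OF P]]]])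
      (use assms in \<open>simp_all add: field_simps power2_eq_square\<close>)
qed

lemma weight_pos: "weight t > 0"
  by (simp add: weight_def)

lemma weight_deriv:
  assumes "t > 0"
  shows "(weight has_real_derivative lam * t powr (-r) * weight t) (at t)"
  unfolding weight_def
  by (rule has_real_derivative_powr_div[OF assms] derivative_eq_intros refl)+
    (use assms r in \<open>simp_all add: powr_diff powr_minus field_simps\<close>)

lemma lyap_deriv:
  fixes z :: 'a
  assumes t: "t > t0" and v': "(v has_vector_derivative acc t) (at t)"
  defines "A \<equiv> t powr (-r)" and "Q \<equiv> t powr (-q)" and "B \<equiv> t powr (-p)" and "D \<equiv> t powr (r - p - 1)"
    and "\<tau> \<equiv> 1 / t" and "w \<equiv> x t - z"
  defines "\<kappa>' \<equiv> - (r * (r + 1) * A * \<tau>\<^sup>2) - \<alpha> * (r + q) * A * Q * \<tau> + 2 * r * lam * A\<^sup>2 * \<tau>"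
  shows "(lyap K z i has_real_derivative
     (g i (x t) \<bullet> v t + \<beta> / 2 * (- (p * B * \<tau>) * (x t \<bullet> x t - z \<bullet> z) + 2 * B * (x t \<bullet> v t)) + acc t \<bullet> v t
     + lam * (- (r * A * \<tau>) * (w \<bullet> v t) + A * (v t \<bullet> v t + w \<bullet> acc t))
     + lam / 2 * (\<kappa>' * (w \<bullet> w) + 2 * kappa t * (w \<bullet> v t)) - K * ((r - p - 1) * D * \<tau>))) (at t)"
proof -
  have "t > 0" using t t0 by simp
  have w': "((\<lambda>t. x t - z) has_vector_derivative v t) (at t)"
    using x_deriv[OF t] by (auto intro!: derivative_eq_intros)
  have d1: "((\<lambda>t. x t \<bullet> x t) has_real_derivative 2 * (x t \<bullet> v t)) (at t)"
    using has_real_derivative_inner[OF x_deriv[OF t] x_deriv[OF t]] by (simp add: inner_commute)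
  have d2: "((\<lambda>t. v t \<bullet> v t) has_real_derivative 2 * (acc t \<bullet> v t)) (at t)"
    using has_real_derivative_inner[OF v' v'] by (simp add: inner_commute)
  have d3: "((\<lambda>t. (x t - z) \<bullet> (x t - z)) has_real_derivative 2 * (w \<bullet> v t)) (at t)"
    using has_real_derivative_inner[OF w' w'] by (simp add: inner_commute w_def)
  have d4: "((\<lambda>t. (x t - z) \<bullet> v t) has_real_derivative (w \<bullet> acc t + v t \<bullet> v t)) (at t)"
    using has_real_derivative_inner[OF w' v'] by (simp add: w_def)
  show ?thesis
    unfolding lyap_def
    by (rule has_real_derivative_powr_div[OF \<open>t > 0\<close>] kappa_deriv[OF \<open>t > 0\<close>]
        d1 d2 d3 d4 fx_deriv[OF t] derivative_eq_intros refl)+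
      (simp add: A_def Q_def B_def D_def \<tau>_def w_def \<kappa>'_def algebra_simps
        add_divide_distrib diff_divide_distrib)
qed

lemma dom_lyap:
  assumes "t0 \<le> a"
  shows "inc_dominated {a..b} v (lyap K z i)"
proof -
  have kap: "inc_dominated {a..b} v kappa"
  proof (rule inc_dominated_real_C1)
    fix t assume "t \<in> {a..b}"
    then show "(kappa has_real_derivative - (r * (r + 1) * t powr (-r) * (1/t)\<^sup>2)
     - \<alpha> * (r + q) * t powr (-r) * t powr (-q) * (1/t) + 2 * r * lam * (t powr (-r))\<^sup>2 * (1/t)) (at t)"
      using assms t0 by (intro kappa_deriv) auto
  qed (use assms t0 in \<open>auto intro!: continuous_intros\<close>)
  have eq: "lyap K z i = (\<lambda>t. (f i (x t) + - f i z + \<beta> / 2 * (t powr (-p) * (x t \<bullet> x t + - (z \<bullet> z))))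
     + (1/2 * (v t \<bullet> v t) + lam * (t powr (-r) * ((x t - z) \<bullet> v t))
     + lam / 2 * (kappa t * ((x t - z) \<bullet> (x t - z))) + (- K) * t powr (r - p - 1)))"
    by (rule ext) (simp add: lyap_def)
  show ?thesis unfolding eq
    by (intro inc_dominated_add dom_mult dom_inner dom_const dom_fx dom_powr dom_x dom_x_diff
        inc_dominated_self kap assms)
qed

lemma dom_weight:
  assumes "t0 \<le> a"
  shows "inc_dominated {a..b} v weight"
proof (rule inc_dominated_real_C1)
  fix t assume "t \<in> {a..b}"
  then show "(weight has_real_derivative lam * t powr (-r) * weight t) (at t)"
    using assms t0 by (intro weight_deriv) auto
qed (use assms t0 r in \<open>auto intro!: continuous_intros simp: weight_def\<close>)

text \<open>In \<open>lyapunov_dissipation\<close>, \<open>h1\<close> is the variational inequality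
  and \<open>h2\<close> is convexity at an active index. The condition on \<open>K\<close>
  constrains \<open>z\<close> only through its norm, so one \<open>K\<close> serves a whole
  ball.\<close>

lemma weighted_lyap_antimono:
  assumes a: "a > t0" "a \<ge> 1" "3 * r \<le> lam * a powr (1 - r)" "2 * (p + 1 - r) \<le> lam * a powr (1 - r)"
    and "a \<le> b" and K: "0 \<le> K" "p * \<beta> * (z \<bullet> z) \<le> K * lam"
  shows "Min (range (\<lambda>i. weight b * lyap K z i b)) \<le> Min (range (\<lambda>i. weight a * lyap K z i a))"
proof -
  obtain N where N: "negligible N"
    and v': "\<And>t. t \<ge> t0 \<Longrightarrow> t \<notin> N \<Longrightarrow> (v has_vector_derivative acc t) (at t)"
    and acc: "\<And>t. t \<ge> t0 \<Longrightarrow> t \<notin> N \<Longrightarrow> \<exists>\<xi> \<in> convex hull (range (\<lambda>i. g i (x t))).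
          acc t = - ((\<alpha> / t powr q) *\<^sub>R v t) - \<xi> - (\<beta> / t powr p) *\<^sub>R x t"
    and var: "\<And>t i. t \<ge> t0 \<Longrightarrow> t \<notin> N \<Longrightarrow>
          g i (x t) \<bullet> v t + \<beta> / t powr p * (x t \<bullet> v t) + acc t \<bullet> v t \<le> - (\<alpha> / t powr q) * (v t \<bullet> v t)"
    using variational by metis
  define dl where "dl i t = (g i (x t) \<bullet> v t + \<beta> / 2 * (- (p * t powr (-p) * (1/t)) * (x t \<bullet> x t - z \<bullet> z)
       + 2 * t powr (-p) * (x t \<bullet> v t)) + acc t \<bullet> v t
     + lam * (- (r * t powr (-r) * (1/t)) * ((x t - z) \<bullet> v t) + t powr (-r) * (v t \<bullet> v t + (x t - z) \<bullet> acc t))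
     + lam / 2 * ((- (r * (r + 1) * t powr (-r) * (1/t)\<^sup>2) - \<alpha> * (r + q) * t powr (-r) * t powr (-q) * (1/t)
         + 2 * r * lam * (t powr (-r))\<^sup>2 * (1/t)) * ((x t - z) \<bullet> (x t - z)) + 2 * kappa t * ((x t - z) \<bullet> v t))
     - K * ((r - p - 1) * t powr (r - p - 1) * (1/t)))" for i t
  show ?thesis
  proof (rule Min_antimono_if_active_deriv_nonpos[OF \<open>a \<le> b\<close> v_ac_subinterval _ N])
    show "t0 \<le> a" using a by simp
    then show "inc_dominated {a..b} v (\<lambda>t. weight t * lyap K z i t)" for i
      by (intro dom_mult dom_weight dom_lyap)
    fix i t assume tN: "t \<in> {a..b} - N"
    then have t: "t > t0" "t \<ge> t0" "t \<notin> N" "t \<ge> 1" "t > 0" "a \<le> t" using a by auto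
    show "((\<lambda>t. weight t * lyap K z i t) has_real_derivative
        lam * t powr (-r) * weight t * lyap K z i t + dl i t * weight t) (at t)"
      unfolding dl_def by (intro DERIV_mult weight_deriv lyap_deriv t v')
    assume act: "\<And>j. weight t * lyap K z i t \<le> weight t * lyap K z j t"
    have f_le: "f i (x t) - f i z \<le> f j (x t) - f j z" for j
    proof -
      have "lyap K z i t \<le> lyap K z j t" using act[of j] weight_pos[of t] by simp
      then show ?thesis unfolding lyap_def by linarith
    qed
    define w where "w = x t - z"
    obtain \<xi> where \<xi>: "\<xi> \<in> convex hull (range (\<lambda>i. g i (x t)))"
        "acc t = - ((\<alpha> / t powr q) *\<^sub>R v t) - \<xi> - (\<beta> / t powr p) *\<^sub>R x t"
      using acc[OF t(2,3)] by blast
    have "f i (x t) - f i z \<le> w \<bullet> \<xi>"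
    proof -
      \<comment> \<open>A half-space is convex, so only the generators of the hull need checking;
        there the bound is the gradient inequality combined with the activity of
        \<open>i\<close>.\<close>
      have "convex hull (range (\<lambda>i. g i (x t))) \<subseteq> {u. w \<bullet> u \<ge> f i (x t) - f i z}"
      proof (rule hull_minimal)
        have "f j (x t) + g j (x t) \<bullet> (z - x t) \<le> f j z" for j
          by (rule convex_on_gradient_ineq[OF conv grad])
        then have "f i (x t) - f i z \<le> w \<bullet> g j (x t)" for j
          using f_le[of j] by (simp add: w_def algebra_simps inner_commute) (smt (verit))
        then show "range (\<lambda>i. g i (x t)) \<subseteq> {u. w \<bullet> u \<ge> f i (x t) - f i z}" by auto
        show "convex {u. w \<bullet> u \<ge> f i (x t) - f i z}" by (rule convex_halfspace_ge)
      qed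
      then show ?thesis using \<xi>(1) by auto
    qed
    \<comment> \<open>This polarization splits the Tikhonov force into the regularizing part of the
      gap and a surplus \<open>w \<bullet> w\<close>, the source of the good term
      \<open>\<beta> * A * B\<close> in the coefficient of \<open>X\<close>.\<close>
    moreover have "w \<bullet> x t = (x t \<bullet> x t - z \<bullet> z + w \<bullet> w) / 2"
      by (simp add: w_def algebra_simps inner_commute)
    then have "w \<bullet> acc t = - (\<alpha> * t powr (-q) * (w \<bullet> v t)) - w \<bullet> \<xi>
        - \<beta> / 2 * t powr (-p) * (x t \<bullet> x t - z \<bullet> z + w \<bullet> w)"
    proof -
      have "w \<bullet> acc t = - (\<alpha> * t powr (-q) * (w \<bullet> v t)) - w \<bullet> \<xi> - \<beta> * t powr (-p) * (w \<bullet> x t)"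
        unfolding \<xi>(2) inner_diff_right by (simp add: powr_minus divide_inverse)
      then show ?thesis unfolding \<open>w \<bullet> x t = (x t \<bullet> x t - z \<bullet> z + w \<bullet> w) / 2\<close> by simp
    qed
    ultimately have h2: "w \<bullet> acc t \<le> - (\<alpha> * t powr (-q) * (w \<bullet> v t))
        - (f i (x t) - f i z + \<beta> / 2 * (t powr (-p) * (x t \<bullet> x t - z \<bullet> z)))
        - \<beta> / 2 * t powr (-p) * (w \<bullet> w)"
      by (simp add: algebra_simps add_divide_distrib)
    have h1: "g i (x t) \<bullet> v t + \<beta> * t powr (-p) * (x t \<bullet> v t) + acc t \<bullet> v t \<le> - (\<alpha> * t powr (-q) * (v t \<bullet> v t))"
      using var[OF t(2,3), of i] by (simp add: powr_minus field_simps)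
    \<comment> \<open>The size conditions are given at \<open>a\<close> only; they persist because
      \<open>1 - r\<close> is positive.\<close>
    have "a powr (1 - r) \<le> t powr (1 - r)" using r a t by (intro powr_mono2) auto
    then have "lam * a powr (1 - r) \<le> lam * t powr (1 - r)" using lam by (intro mult_left_mono) auto
    then have large: "3 * r \<le> lam * t powr (1 - r)" "2 * (p + 1 - r) \<le> lam * t powr (1 - r)" using a by linarith+
    have split: "t powr (1 - r) = t * t powr (-r)" using t by (simp add: powr_diff powr_minus field_simps)
    have Dsplit: "t powr (r - p - 1) * t powr (1 - r) = t powr (-p)" by (simp add: powr_add[symmetric])
    have "dl i t + lam * t powr (-r) * (f i (x t) - f i z + \<beta> / 2 * (t powr (-p) * (x t \<bullet> x t - z \<bullet> z))
        + v t \<bullet> v t / 2 + lam * t powr (-r) * (w \<bullet> v t) + lam / 2 * kappa t * (w \<bullet> w) - K * t powr (r - p - 1)) \<le> 0"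
    proof -
      have kap: "kappa t = r * t powr (-r) * (1/t) + \<alpha> * t powr (-r) * t powr (-q) - lam * (t powr (-r))\<^sup>2"
        by (simp add: kappa_def)
      show ?thesis
        unfolding dl_def kap w_def[symmetric]
      proof (rule lyapunov_dissipation[OF _ _ _ _ _ _ _ K(1) \<alpha> \<beta> p(1) q(1) r_pos lam h1 h2 _ _ _ _ _ K(2)])
        show "t powr (-r) \<le> t powr (-q)" using r t by (intro powr_mono) auto
        have "t powr (-r) * t powr (-q) = t powr (-r + -q)" by (simp only: powr_add)
        also have "\<dots> \<le> t powr (-p)" using r t by (intro powr_mono) auto
        finally show "t powr (-r) * t powr (-q) \<le> t powr (-p)" .
        show "3 * r * (1/t) \<le> lam * t powr (-r)" using large(1) t unfolding split by (simp add: field_simps)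
        have "t powr (-r) * t powr (r - p - 1) = t powr (-p - 1)" by (simp add: powr_add[symmetric])
        then show "t powr (-r) * t powr (r - p - 1) = t powr (-p) * (1/t)" using t by (simp add: powr_diff)
        have "2 * (p + 1 - r) * t powr (r - p - 1) \<le> lam * t powr (1 - r) * t powr (r - p - 1)"
          using large(2) by (intro mult_right_mono) auto
        then show "2 * (p + 1 - r) * t powr (r - p - 1) \<le> lam * t powr (-p)"
          using Dsplit by (simp add: mult_ac)
      qed (use t in simp_all)
    qed
    then have "lam * t powr (-r) * lyap K z i t + dl i t \<le> 0"
      unfolding lyap_def w_def by (simp add: algebra_simps add_divide_distrib)
    then have "weight t * (lam * t powr (-r) * lyap K z i t + dl i t) \<le> 0"
      using weight_pos[of t] by (intro mult_nonneg_nonpos) auto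
    then show "lam * t powr (-r) * weight t * lyap K z i t + dl i t * weight t \<le> 0"
      by (simp add: algebra_simps)
  qed
qed

end

section \<open>Energy estimates\<close>

context mtrigs_lyapunov
begin

abbreviation zt :: "real \<Rightarrow> 'a" where
  "zt t \<equiv> zpt \<beta> p f t (x t)"

definition energy_real :: "real \<Rightarrow> real" where
  "energy_real t = t powr (2*r) * merit_real t (x t)
     + ((norm (lam *\<^sub>R (x t - zt t) + (t powr r) *\<^sub>R v t))\<^sup>2 / 2
     + lam / 2 * (r * t powr (r-1) + \<alpha> * t powr (r-q) - 2*lam) * (norm (x t - zt t))\<^sup>2)"

lemma energy_eq: "t > 0 \<Longrightarrow> energy \<alpha> \<beta> q p f x v r lam t = ereal (energy_real t)"
  unfolding energy_def energy_real_def by (simp add: merit_t_eq)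

text \<open>The freezing is undone at a single time, which needs no derivative of \<open>zt\<close>.
  Everything but the gap is independent of the index and leaves the minimum; the square in the
  energy expands into the kinetic, cross and \<open>kappa\<close> terms. Any \<open>K\<close> is
  allowed since its term is added back.\<close>

lemma energy_real_eq_lyap:
  assumes "t > 0"
  shows "energy_real t = t powr (2*r) * (Min (range (\<lambda>i. lyap K (zt t) i t)) + K * t powr (r - p - 1))"
proof -
  define w where "w = x t - zt t"
  define u where "u = t powr r"
  have "u > 0" using assms by (simp add: u_def)
  have pw: "t powr (-r) = 1 / u" "t powr (2*r) = u\<^sup>2" "t powr (r - 1) = u / t" "t powr (r - q) = u * t powr (-q)"
    using assms by (simp_all add: u_def powr_minus powr_diff field_simps powr_add[symmetric] power2_eq_square)
  define c where "c = 1/2 * (v t \<bullet> v t) + lam * (t powr (-r) * (w \<bullet> v t)) + lam / 2 * (kappa t * (w \<bullet> w))"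
  have "lyap K (zt t) i t = (freg \<beta> p f t i (x t) - freg \<beta> p f t i (zt t)) + (c - K * t powr (r - p - 1))" for i
    unfolding lyap_def freg_def c_def w_def power2_norm_eq_inner using assms
    by (simp add: powr_minus field_simps)
  then have "Min (range (\<lambda>i. lyap K (zt t) i t)) =
      Min (range (\<lambda>i. (freg \<beta> p f t i (x t) - freg \<beta> p f t i (zt t)) + (c - K * t powr (r - p - 1))))" by simp
  also have "\<dots> = merit_real t (x t) + (c - K * t powr (r - p - 1))"
    by (rule Min_add_commute) auto
  finally have "t powr (2*r) * (Min (range (\<lambda>i. lyap K (zt t) i t)) + K * t powr (r - p - 1))
      = t powr (2*r) * (merit_real t (x t) + c)" by simp
  then have "t powr (2*r) * (Min (range (\<lambda>i. lyap K (zt t) i t)) + K * t powr (r - p - 1))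
      = t powr (2*r) * merit_real t (x t) + u\<^sup>2 * c"
    unfolding pw(2) distrib_left .
  moreover have "u\<^sup>2 * c = (norm (lam *\<^sub>R w + u *\<^sub>R v t))\<^sup>2 / 2
      + lam / 2 * (r * (u / t) + \<alpha> * (u * t powr (-q)) - 2*lam) * (w \<bullet> w)"
    unfolding c_def kappa_def pw power2_norm_eq_inner using \<open>u > 0\<close> assms
    by (simp add: inner_add_left inner_add_right inner_commute[of "v t" w] field_simps power2_eq_square)
  ultimately show ?thesis
    unfolding energy_real_def pw w_def[symmetric] u_def[symmetric] power2_norm_eq_inner by simp
qed

lemma zt_bounded:
  obtains R where "R > 0" and "\<And>t. t \<ge> t0 \<Longrightarrow> norm (zt t) \<le> R"
    and "\<And>t. t \<ge> t0 \<Longrightarrow> \<exists>m. merit f (x t) = ereal m \<and> 0 \<le> m \<and> m \<le> merit_real t (x t) + \<beta> / (2 * t powr p) * R\<^sup>2"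
proof -
  obtain R where "R > 0" and R: "\<And>t. t \<ge> t0 \<Longrightarrow>
    \<exists>z0 \<in> argmin_set (\<lambda>z. Max (range (\<lambda>i. f i z - f i (x t)))). norm z0 \<le> R"
    by (rule argmin_bounded) blast
  show thesis
  proof (rule that[OF \<open>R > 0\<close>])
    fix t assume t: "t \<ge> t0"
    then have "t > 0" using t0 by simp
    obtain z0 where z0: "z0 \<in> argmin_set (\<lambda>z. Max (range (\<lambda>i. f i z - f i (x t))))" "norm z0 \<le> R"
      using R[OF t] by blast
    show "norm (zt t) \<le> R" using norm_zpt_le[OF \<open>t > 0\<close> z0(1)] z0(2) by simp
    obtain m where m: "merit f (x t) = ereal m" "0 \<le> m"
        "m \<le> merit_real t (x t) + \<beta> / (2 * t powr p) * (norm z0)\<^sup>2"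
      using merit_le_merit_real[OF \<open>t > 0\<close> z0(1)] .
    have "\<beta> / (2 * t powr p) * (norm z0)\<^sup>2 \<le> \<beta> / (2 * t powr p) * R\<^sup>2"
      using z0(2) \<beta> by (intro mult_left_mono power_mono) auto
    with m show "\<exists>m. merit f (x t) = ereal m \<and> 0 \<le> m \<and> m \<le> merit_real t (x t) + \<beta> / (2 * t powr p) * R\<^sup>2"
      by fastforce
  qed
qed

text \<open>The value at the start time must be bounded uniformly over a ball, which is not compact
  in infinite dimension. The tangent inequality at 0 provides the lower bound for \<open>f i\<close>
  that continuity would not.\<close>

lemma lyap_bounded_above:
  assumes "R > 0" "K \<ge> 0" "t > 0"
  obtains C where "C \<ge> 0" and "\<And>z. norm z \<le> R \<Longrightarrow> Min (range (\<lambda>i. weight t * lyap K z i t)) \<le> C"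
proof -
  \<comment> \<open>One index is enough, as the minimum lies below each member.\<close>
  fix i :: 'm
  define L where "L = f i (x t) - f i 0 + norm (g i 0) * R + \<beta> / 2 * (t powr (-p) * (x t \<bullet> x t)) + 1/2 * (v t \<bullet> v t)
    + lam * (t powr (-r) * ((norm (x t) + R) * norm (v t))) + lam / 2 * (\<bar>kappa t\<bar> * (norm (x t) + R)\<^sup>2)"
  have "lyap K z i t \<le> L" if z: "norm z \<le> R" for z
  proof -
    have nw: "norm (x t - z) \<le> norm (x t) + R" using norm_triangle_ineq4[of "x t" z] z by linarith
    have "f i 0 + g i 0 \<bullet> (z - 0) \<le> f i z" by (rule convex_on_gradient_ineq[OF conv grad])
    moreover have "\<bar>g i 0 \<bullet> z\<bar> \<le> norm (g i 0) * norm z" by (rule Cauchy_Schwarz_ineq2)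
    moreover have "norm (g i 0) * norm z \<le> norm (g i 0) * R" using z by (intro mult_left_mono) auto
    ultimately have a: "- f i z \<le> - f i 0 + norm (g i 0) * R" by simp
    have "\<beta> / 2 * (t powr (-p) * (x t \<bullet> x t - z \<bullet> z)) \<le> \<beta> / 2 * (t powr (-p) * (x t \<bullet> x t))"
      using \<beta> by (intro mult_left_mono) auto
    moreover have "lam * (t powr (-r) * ((x t - z) \<bullet> v t)) \<le> lam * (t powr (-r) * ((norm (x t) + R) * norm (v t)))"
    proof -
      have "(x t - z) \<bullet> v t \<le> norm (x t - z) * norm (v t)" by (rule norm_cauchy_schwarz)
      also have "\<dots> \<le> (norm (x t) + R) * norm (v t)" using nw by (intro mult_right_mono) auto
      finally show ?thesis using lam by (intro mult_left_mono) auto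
    qed
    moreover have "lam / 2 * (kappa t * ((x t - z) \<bullet> (x t - z))) \<le> lam / 2 * (\<bar>kappa t\<bar> * (norm (x t) + R)\<^sup>2)"
    proof -
      have "(x t - z) \<bullet> (x t - z) \<le> (norm (x t) + R)\<^sup>2"
        unfolding power2_norm_eq_inner[symmetric] using nw by (intro power_mono) auto
      then have "kappa t * ((x t - z) \<bullet> (x t - z)) \<le> \<bar>kappa t\<bar> * (norm (x t) + R)\<^sup>2"
        by (intro mult_mono) auto
      then show ?thesis using lam by (intro mult_left_mono) auto
    qed
    moreover have "0 \<le> K * t powr (r - p - 1)" using assms by simp
    ultimately show ?thesis unfolding lyap_def L_def using a by linarith
  qed
  show thesis
  proof (rule that[of "weight t * \<bar>L\<bar>"])
    show "0 \<le> weight t * \<bar>L\<bar>" using weight_pos[of t] by simp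
    fix z :: 'a assume z: "norm z \<le> R"
    have "Min (range (\<lambda>i. weight t * lyap K z i t)) \<le> weight t * lyap K z i t" by (rule Min_le) auto
    also have "\<dots> \<le> weight t * \<bar>L\<bar>"
      using \<open>\<And>z. norm z \<le> R \<Longrightarrow> lyap K z i t \<le> L\<close>[OF z] weight_pos[of t] by (intro mult_left_mono) auto
    finally show "Min (range (\<lambda>i. weight t * lyap K z i t)) \<le> weight t * \<bar>L\<bar>" .
  qed
qed

lemma eventually_weight_large: "\<forall>\<^sub>F t in at_top. 1 / weight t \<le> t powr (r - p - 1)"
proof -
  define c s where "c = lam / (1 - r)" and "s = 1 - r"
  have "c > 0" "s > 0" using lam r by (simp_all add: c_def s_def)
  then have "((\<lambda>t. t powr (p + 1 - r) / exp (c * t powr s)) \<longlongrightarrow> 0) at_top" by real_asymp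
  then have "\<forall>\<^sub>F t in at_top. t powr (p + 1 - r) / exp (c * t powr s) < 1"
    by (rule order_tendstoD) simp
  then show ?thesis using eventually_gt_at_top[of 0]
  proof eventually_elim
    case (elim t)
    have "t powr (r - p - 1) = 1 / t powr (p + 1 - r)"
      using powr_minus_divide[of t "p + 1 - r"] by (simp add: algebra_simps)
    moreover have "t powr (p + 1 - r) > 0" "weight t > 0" using elim weight_pos by auto
    moreover from this have "t powr (p + 1 - r) < weight t"
      using elim by (simp add: weight_def c_def s_def divide_less_eq)
    ultimately show ?case by (simp add: frac_le)
  qed
qed

lemma energy_real_upper:
  obtains C where "C \<ge> 0" and "\<forall>\<^sub>F t in at_top. energy_real t \<le> C * t powr (3*r - (p+1))"
proof -
  obtain R where "R > 0" and R: "\<And>t. t \<ge> t0 \<Longrightarrow> norm (zt t) \<le> R" using zt_bounded by metis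
  \<comment> \<open>This turns the condition on \<open>K\<close> into an equality when the norm of
    \<open>z\<close> is \<open>R\<close>.\<close>
  define K where "K = p * \<beta> * R\<^sup>2 / lam"
  have "K \<ge> 0" using p \<beta> lam by (simp add: K_def)
  obtain T where T: "T > t0" "T \<ge> 1" "3 * r \<le> lam * T powr (1 - r)" "2 * (p + 1 - r) \<le> lam * T powr (1 - r)"
    using eventually_happens[OF eventually_large] by auto
  then have "T > 0" by simp
  obtain C where "C \<ge> 0" and C: "\<And>z. norm z \<le> R \<Longrightarrow> Min (range (\<lambda>i. weight T * lyap K z i T)) \<le> C"
    using lyap_bounded_above[OF \<open>R > 0\<close> \<open>K \<ge> 0\<close> \<open>T > 0\<close>] by metis
  have "\<forall>\<^sub>F t in at_top. energy_real t \<le> (C + K) * t powr (3*r - (p+1))"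
    using eventually_weight_large eventually_ge_at_top[of T]
  proof eventually_elim
    case (elim t)
    then have "t \<ge> t0" "t > 0" using T t0 by auto
    define M where "M = Min (range (\<lambda>i. lyap K (zt t) i t))"
    have "zt t \<bullet> zt t \<le> R\<^sup>2"
      unfolding power2_norm_eq_inner[symmetric] by (intro power_mono R \<open>t \<ge> t0\<close>) simp
    then have "p * \<beta> * (zt t \<bullet> zt t) \<le> p * \<beta> * R\<^sup>2" using p \<beta> by (intro mult_left_mono) auto
    also have "\<dots> = K * lam" using lam by (simp add: K_def)
    finally have "Min (range (\<lambda>i. weight t * lyap K (zt t) i t)) \<le> Min (range (\<lambda>i. weight T * lyap K (zt t) i T))"
      by (intro weighted_lyap_antimono T elim \<open>K \<ge> 0\<close>)
    also have "\<dots> \<le> C" by (intro C R \<open>t \<ge> t0\<close>)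
    finally have "Min (range (\<lambda>i. weight t * lyap K (zt t) i t)) \<le> C" .
    moreover obtain j where j: "Min (range (\<lambda>i. weight t * lyap K (zt t) i t)) = weight t * lyap K (zt t) j t"
      by (rule Min_range_attained)
    moreover have "weight t * M \<le> weight t * lyap K (zt t) j t"
      unfolding M_def using weight_pos[of t] by (intro mult_left_mono Min_le) auto
    ultimately have "weight t * M \<le> C" by simp
    then have "M \<le> C * (1 / weight t)" using weight_pos[of t] by (simp add: field_simps)
    also have "\<dots> \<le> C * t powr (r - p - 1)" using elim \<open>C \<ge> 0\<close> by (intro mult_left_mono)
    finally have "M + K * t powr (r - p - 1) \<le> (C + K) * t powr (r - p - 1)" by (simp add: algebra_simps)
    then have "energy_real t \<le> t powr (2*r) * ((C + K) * t powr (r - p - 1))"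
      unfolding energy_real_eq_lyap[OF \<open>t > 0\<close>, of K] M_def by (intro mult_left_mono) auto
    also have "\<dots> = (C + K) * (t powr (2*r) * t powr (r - p - 1))" by simp
    also have "t powr (2*r) * t powr (r - p - 1) = t powr (3*r - (p+1))"
      by (simp add: powr_add[symmetric] algebra_simps)
    finally show ?case .
  qed
  with \<open>C \<ge> 0\<close> \<open>K \<ge> 0\<close> show thesis by (intro that[of "C + K"]) auto
qed

text \<open>Needed for the absolute value in claim (i), since for \<open>lam > \<alpha> / 2\<close>
  the last coefficient of the energy can be negative. Strong convexity compensates:
  \<open>q \<le> r\<close> and \<open>p - q \<le> r\<close> give \<open>p \<le> 2 * r\<close>, so
  the weighted merit is at least \<open>\<beta> / 4\<close> times the same square.\<close>

lemma energy_real_nonneg: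
  assumes "t \<ge> 1"
  shows "0 \<le> energy_real t"
proof -
  define X where "X = (norm (x t - zt t))\<^sup>2"
  have "X \<ge> 0" by (simp add: X_def)
  have "\<beta> / 4 * X = t powr p * (\<beta> / (4 * t powr p) * X)" using assms by simp
  also have "\<dots> \<le> t powr (2*r) * (\<beta> / (4 * t powr p) * X)"
    using assms r \<beta> \<open>X \<ge> 0\<close> by (intro mult_right_mono powr_mono) auto
  also have "\<dots> \<le> t powr (2*r) * merit_real t (x t)"
    unfolding X_def using assms by (intro mult_left_mono merit_real_ge_norm_diff) auto
  finally have a: "\<beta> / 4 * X \<le> t powr (2*r) * merit_real t (x t)" .
  have "1 \<le> t powr (r - q)" using assms r by (intro ge_one_powr_ge_zero) auto
  then have "\<alpha> * 1 \<le> \<alpha> * t powr (r - q)" using \<alpha> by (intro mult_left_mono) auto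
  moreover have "0 \<le> r * t powr (r-1)" using r_pos by simp
  ultimately have "\<alpha> - 2 * lam \<le> r * t powr (r-1) + \<alpha> * t powr (r-q) - 2*lam" by linarith
  then have b: "lam / 2 * (\<alpha> - 2 * lam) * X \<le> lam / 2 * (r * t powr (r-1) + \<alpha> * t powr (r-q) - 2*lam) * X"
    using lam \<open>X \<ge> 0\<close> by (intro mult_right_mono mult_left_mono) auto
  \<comment> \<open>With this the total coefficient is at least
    \<open>lam * (3 / 4 * \<alpha> - lam)\<close>, and \<open>2 / 3 < 3 / 4\<close>.\<close>
  have "lam * \<alpha> \<le> \<beta>" using lam \<alpha> by (simp add: field_simps)
  moreover have "lam * lam \<le> lam * (3 / 4 * \<alpha>)" using lam \<alpha> by (intro mult_left_mono) auto
  ultimately have "0 \<le> \<beta> / 4 + lam / 2 * (\<alpha> - 2 * lam)" by (simp add: algebra_simps)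
  then have "0 \<le> (\<beta> / 4 + lam / 2 * (\<alpha> - 2 * lam)) * X" using \<open>X \<ge> 0\<close> by (intro mult_nonneg_nonneg)
  also have "\<dots> = \<beta> / 4 * X + lam / 2 * (\<alpha> - 2 * lam) * X" by (simp add: algebra_simps)
  finally show ?thesis unfolding energy_real_def X_def[symmetric]
    using a b zero_le_power2[of "norm (lam *\<^sub>R (x t - zt t) + (t powr r) *\<^sub>R v t)"] by linarith
qed

lemma energy_rate:
  "\<exists>C. \<forall>\<^sub>F t in at_top. \<bar>energy \<alpha> \<beta> q p f x v r lam t\<bar> \<le> ereal (C * t powr (3*r - (p+1)))"
proof -
  obtain C where C: "\<forall>\<^sub>F t in at_top. energy_real t \<le> C * t powr (3*r - (p+1))"
    using energy_real_upper by metis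
  have "\<forall>\<^sub>F t in at_top. \<bar>energy \<alpha> \<beta> q p f x v r lam t\<bar> \<le> ereal (C * t powr (3*r - (p+1)))"
    using C eventually_ge_at_top[of 1]
    by eventually_elim (use energy_real_nonneg in \<open>simp add: energy_eq\<close>)
  then show ?thesis by blast
qed

text \<open>For \<open>lam \<le> \<alpha> / 2\<close> and \<open>t \<ge> 1\<close> the three parts
  of the energy are nonnegative, so each obeys the energy bound. Quadratic growth of the merit then
  controls \<open>x t - zt t\<close>, and the triangle inequality in the mixed square controls
  \<open>v t\<close>.\<close>

lemma eventually_rates:
  assumes "lam \<le> \<alpha> / 2"
  obtains C where "C \<ge> 0"
    and "\<forall>\<^sub>F t in at_top. merit_real t (x t) \<le> C * t powr (r - (p+1))"
    and "\<forall>\<^sub>F t in at_top. norm (x t - zt t) \<le> C * t powr ((r-1)/2)"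
    and "\<forall>\<^sub>F t in at_top. norm (v t) \<le> C * t powr ((r-(p+1))/2)"
proof -
  obtain C0 where "C0 \<ge> 0" and C0: "\<forall>\<^sub>F t in at_top. energy_real t \<le> C0 * t powr (3*r - (p+1))"
    using energy_real_upper by metis
  \<comment> \<open>\<open>C1\<close> inverts the growth constant
    \<open>\<beta> / (4 * t powr p)\<close>; \<open>C2\<close> collects the two terms of the
    triangle inequality for the velocity.\<close>
  define C1 where "C1 = sqrt (4 * C0 / \<beta>)"
  define C2 where "C2 = sqrt (2 * C0) + lam * C1"
  have nonneg: "C1 \<ge> 0" "C2 \<ge> 0" using \<open>C0 \<ge> 0\<close> \<beta> lam by (simp_all add: C1_def C2_def)
  have ev: "\<forall>\<^sub>F t in at_top. merit_real t (x t) \<le> C0 * t powr (r - (p+1)) \<and>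
      norm (x t - zt t) \<le> C1 * t powr ((r-1)/2) \<and> norm (v t) \<le> C2 * t powr ((r-(p+1))/2)"
    using C0 eventually_ge_at_top[of 1]
  proof eventually_elim
    case (elim t)
    then have "t > 0" by simp
    define w where "w = x t - zt t"
    have "1 \<le> t powr (r - q)" using elim r by (intro ge_one_powr_ge_zero) auto
    then have "\<alpha> * 1 \<le> \<alpha> * t powr (r - q)" using \<alpha> by (intro mult_left_mono) auto
    moreover have "0 \<le> r * t powr (r-1)" using r_pos by simp
    ultimately have "0 \<le> r * t powr (r-1) + \<alpha> * t powr (r-q) - 2*lam" using assms by linarith
    then have "0 \<le> lam / 2 * (r * t powr (r-1) + \<alpha> * t powr (r-q) - 2*lam) * (norm w)\<^sup>2"
      using lam by (intro mult_nonneg_nonneg) auto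
    moreover have "0 \<le> t powr (2*r) * merit_real t (x t)"
      using merit_t_eq(2)[OF \<open>t > 0\<close>] by (intro mult_nonneg_nonneg) auto
    moreover have "0 \<le> (norm (lam *\<^sub>R w + (t powr r) *\<^sub>R v t))\<^sup>2 / 2" by simp
    ultimately have m: "t powr (2*r) * merit_real t (x t) \<le> C0 * t powr (3*r - (p+1))"
      and n: "(norm (lam *\<^sub>R w + (t powr r) *\<^sub>R v t))\<^sup>2 / 2 \<le> C0 * t powr (3*r - (p+1))"
      using elim(1) unfolding energy_real_def w_def[symmetric] by linarith+
    have "t powr (3*r - (p+1)) = t powr (2*r) * t powr (r - (p+1))"
      by (simp add: powr_add[symmetric] algebra_simps)
    then have "t powr (2*r) * merit_real t (x t) \<le> t powr (2*r) * (C0 * t powr (r - (p+1)))"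
      using m by (simp add: mult_ac)
    moreover have "t powr (2*r) > 0" using \<open>t > 0\<close> by simp
    ultimately have merit: "merit_real t (x t) \<le> C0 * t powr (r - (p+1))"
      by (simp only: mult_le_cancel_left_pos)
    have "\<beta> / (4 * t powr p) * (norm w)\<^sup>2 \<le> C0 * t powr (r - (p+1))"
      using merit_real_ge_norm_diff[OF \<open>t > 0\<close>] merit order_trans unfolding w_def by blast
    then have "(norm w)\<^sup>2 \<le> 4 * C0 / \<beta> * (t powr p * t powr (r - (p+1)))"
      using \<beta> \<open>t > 0\<close> by (simp add: field_simps)
    also have "t powr p * t powr (r - (p+1)) = (t powr ((r-1)/2))\<^sup>2"
      using \<open>t > 0\<close> by (simp add: powr_add[symmetric] power2_eq_square)
    also have "4 * C0 / \<beta> * (t powr ((r-1)/2))\<^sup>2 = (C1 * t powr ((r-1)/2))\<^sup>2"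
      using \<open>C0 \<ge> 0\<close> \<beta> by (simp add: C1_def power_mult_distrib)
    finally have w: "norm w \<le> C1 * t powr ((r-1)/2)"
      by (rule power2_le_imp_le) (use nonneg in simp)
    define \<rho> where "\<rho> = t powr ((3*r - (p+1))/2)"
    have "(norm (lam *\<^sub>R w + (t powr r) *\<^sub>R v t))\<^sup>2 \<le> 2 * C0 * t powr (3*r - (p+1))" using n by simp
    also have "\<dots> = (sqrt (2 * C0) * \<rho>)\<^sup>2"
    proof -
      have "\<rho>\<^sup>2 = t powr (3*r - (p+1))" unfolding \<rho>_def power2_eq_square powr_add[symmetric] by simp
      then show ?thesis using \<open>C0 \<ge> 0\<close> by (simp add: power_mult_distrib)
    qed
    finally have a: "norm (lam *\<^sub>R w + (t powr r) *\<^sub>R v t) \<le> sqrt (2 * C0) * \<rho>"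
      by (rule power2_le_imp_le) (use \<open>C0 \<ge> 0\<close> in \<open>simp add: \<rho>_def\<close>)
    \<comment> \<open>The exponents compare by \<open>p \<le> 2 * r\<close>, so the position term
      does not spoil the rate of the velocity.\<close>
    have "t powr ((r-1)/2) \<le> \<rho>" unfolding \<rho>_def using elim r by (intro powr_mono) auto
    then have "C1 * t powr ((r-1)/2) \<le> C1 * \<rho>" using nonneg by (intro mult_left_mono)
    then have "lam * norm w \<le> lam * (C1 * \<rho>)" using w lam by (intro mult_left_mono) auto
    moreover have "norm ((t powr r) *\<^sub>R v t) \<le> norm (lam *\<^sub>R w + (t powr r) *\<^sub>R v t) + norm (lam *\<^sub>R w)"
      using norm_triangle_ineq4[of "lam *\<^sub>R w + (t powr r) *\<^sub>R v t" "lam *\<^sub>R w"] by simp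
    moreover have "norm ((t powr r) *\<^sub>R v t) = t powr r * norm (v t)" "norm (lam *\<^sub>R w) = lam * norm w"
      using lam by simp_all
    ultimately have "t powr r * norm (v t) \<le> sqrt (2 * C0) * \<rho> + lam * (C1 * \<rho>)" using a by linarith
    also have "\<dots> = C2 * \<rho>" by (simp add: C2_def algebra_simps)
    also have "\<rho> = t powr r * t powr ((r - (p+1))/2)"
      by (simp add: \<rho>_def powr_add[symmetric] field_simps)
    finally have "t powr r * norm (v t) \<le> t powr r * (C2 * t powr ((r - (p+1))/2))" by (simp add: mult_ac)
    moreover have "t powr r > 0" using \<open>t > 0\<close> by simp
    ultimately have "norm (v t) \<le> C2 * t powr ((r - (p+1))/2)" by (simp only: mult_le_cancel_left_pos)
    then show ?case using merit w unfolding w_def by simp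
  qed
  define C where "C = C0 + C1 + C2"
  have "C0 \<le> C" "C1 \<le> C" "C2 \<le> C" "C \<ge> 0" using nonneg \<open>C0 \<ge> 0\<close> by (simp_all add: C_def)
  then have mono: "C0 * s powr e \<le> C * s powr e" "C1 * s powr e \<le> C * s powr e" "C2 * s powr e \<le> C * s powr e" for s e :: real
    by (simp_all add: mult_right_mono)
  show thesis
  proof (rule that[OF \<open>C \<ge> 0\<close>])
    show "\<forall>\<^sub>F t in at_top. merit_real t (x t) \<le> C * t powr (r - (p+1))"
      using ev by eventually_elim (rule order_trans[OF _ mono(1)], blast)
    show "\<forall>\<^sub>F t in at_top. norm (x t - zt t) \<le> C * t powr ((r-1)/2)"
      using ev by eventually_elim (rule order_trans[OF _ mono(2)], blast)
    show "\<forall>\<^sub>F t in at_top. norm (v t) \<le> C * t powr ((r-(p+1))/2)"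
      using ev by eventually_elim (rule order_trans[OF _ mono(3)], blast)
  qed
qed

lemma asymptotic_rates:
  assumes "lam \<le> \<alpha> / 2"
  shows "\<exists>C. \<forall>\<^sub>F t in at_top. \<bar>merit_t \<beta> p f t (x t)\<bar> \<le> ereal (C * t powr (r - (p+1)))"
    and "\<exists>C. \<forall>\<^sub>F t in at_top. \<bar>merit f (x t)\<bar> \<le> ereal (C * t powr (-p))"
    and "(\<lambda>t. norm (x t - zt t)) \<in> O(\<lambda>t. t powr ((r-1)/2))"
    and "(\<lambda>t. norm (v t)) \<in> O(\<lambda>t. t powr ((r-(p+1))/2))"
proof -
  obtain C where "C \<ge> 0" and C: "\<forall>\<^sub>F t in at_top. merit_real t (x t) \<le> C * t powr (r - (p+1))"
    "\<forall>\<^sub>F t in at_top. norm (x t - zt t) \<le> C * t powr ((r-1)/2)"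
    "\<forall>\<^sub>F t in at_top. norm (v t) \<le> C * t powr ((r-(p+1))/2)"
    by (rule eventually_rates[OF assms])
  show "\<exists>C. \<forall>\<^sub>F t in at_top. \<bar>merit_t \<beta> p f t (x t)\<bar> \<le> ereal (C * t powr (r - (p+1)))"
  proof
    show "\<forall>\<^sub>F t in at_top. \<bar>merit_t \<beta> p f t (x t)\<bar> \<le> ereal (C * t powr (r - (p+1)))"
      using C(1) eventually_gt_at_top[of 0]
    proof eventually_elim
      case (elim t)
      show ?case
        unfolding merit_t_eq(1)[OF elim(2)] abs_ereal.simps ereal_less_eq(3) abs_of_nonneg[OF merit_t_eq(2)[OF elim(2)]]
        by (rule elim(1))
    qed
  qed
  obtain R where R: "\<And>t. t \<ge> t0 \<Longrightarrow>
      \<exists>m. merit f (x t) = ereal m \<and> 0 \<le> m \<and> m \<le> merit_real t (x t) + \<beta> / (2 * t powr p) * R\<^sup>2"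
    by (rule zt_bounded) blast
  show "\<exists>C. \<forall>\<^sub>F t in at_top. \<bar>merit f (x t)\<bar> \<le> ereal (C * t powr (-p))"
  proof
    show "\<forall>\<^sub>F t in at_top. \<bar>merit f (x t)\<bar> \<le> ereal ((C + \<beta> / 2 * R\<^sup>2) * t powr (-p))"
      using C(1) eventually_ge_at_top[of t0] eventually_ge_at_top[of 1]
    proof eventually_elim
      case (elim t)
      obtain m where m: "merit f (x t) = ereal m" "0 \<le> m" "m \<le> merit_real t (x t) + \<beta> / (2 * t powr p) * R\<^sup>2"
        using R[OF elim(2)] by blast
      \<comment> \<open>By \<open>r < 1\<close> the regularized merit decays faster than the
        Tikhonov term, which sets the rate.\<close>
      have "C * t powr (r - (p+1)) \<le> C * t powr (-p)"
        using \<open>C \<ge> 0\<close> elim r by (intro mult_left_mono powr_mono) auto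
      moreover have "\<beta> / (2 * t powr p) * R\<^sup>2 = \<beta> / 2 * R\<^sup>2 * t powr (-p)"
        by (simp add: powr_minus_divide)
      ultimately have "m \<le> C * t powr (-p) + \<beta> / 2 * R\<^sup>2 * t powr (-p)" using m(3) elim(1) by linarith
      then show ?case using m(1,2) by (simp add: distrib_right)
    qed
  qed
  show "(\<lambda>t. norm (x t - zt t)) \<in> O(\<lambda>t. t powr ((r-1)/2))"
    by (rule bigoI[of _ C]) (use C(2) in simp)
  show "(\<lambda>t. norm (v t)) \<in> O(\<lambda>t. t powr ((r-(p+1))/2))"
    by (rule bigoI[of _ C]) (use C(3) in simp)
qed

end

theorem mainTheorem13:
  fixes f :: "'m::finite \<Rightarrow> 'a::{real_inner,complete_space} \<Rightarrow> real"
    and g :: "'m \<Rightarrow> 'a \<Rightarrow> 'a"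
    and x v acc :: "real \<Rightarrow> 'a"
    and x0 v0 :: 'a
    and t0 \<alpha> \<beta> q p :: real
  assumes conv: "\<And>i. convex_on UNIV (f i)"
    and grad: "\<And>i y. (f i has_derivative (\<lambda>h. g i y \<bullet> h)) (at y)"
    and lip: "\<And>i. \<exists>L. \<forall>y y'. norm (g i y - g i y') \<le> L * norm (y - y')"
    and t0: "t0 > 0" and \<alpha>: "\<alpha> > 0" and \<beta>: "\<beta> > 0"
    and q: "0 < q" "q < 1" and p: "0 < p" "p \<le> 2" "p < q + 1"
    and A3: "A3 f \<beta> p t0 x0 v0" and A4: "A4 f"
    and sol: "MTRIGS_solution g t0 \<alpha> \<beta> q p x0 v0 x v acc"
  shows "\<forall>r. q \<le> r \<and> p - q \<le> r \<and> r < 1 \<longrightarrow>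
     (\<forall>lam. 0 < lam \<and> lam \<le> 2*\<alpha>/3 \<and> lam \<le> \<beta>/\<alpha> \<longrightarrow>
        (\<exists>C. eventually (\<lambda>t. \<bar>energy \<alpha> \<beta> q p f x v r lam t\<bar> \<le> ereal (C * t powr (3*r - (p+1)))) at_top))
   \<and> (\<exists>C. eventually (\<lambda>t. \<bar>merit_t \<beta> p f t (x t)\<bar> \<le> ereal (C * t powr (r - (p+1)))) at_top)
   \<and> (\<exists>C. eventually (\<lambda>t. \<bar>merit f (x t)\<bar> \<le> ereal (C * t powr (-p))) at_top)
   \<and> (\<lambda>t. norm (x t - zpt \<beta> p f t (x t))) \<in> O(\<lambda>t. t powr ((r-1)/2))
   \<and> (\<lambda>t. norm (v t)) \<in> O(\<lambda>t. t powr ((r-(p+1))/2))"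
proof (intro allI impI)
  fix r assume r: "q \<le> r \<and> p - q \<le> r \<and> r < 1"
  interpret mtrigs f \<beta> p g x v acc x0 v0 t0 \<alpha> q
  proof
    show "continuous_on UNIV (f i)" for i
      using grad has_derivative_continuous by (metis continuous_at_imp_continuous_on)
    show "continuous_on UNIV (g i)" for i
    proof -
      obtain L where L: "\<And>y y'. norm (g i y - g i y') \<le> L * norm (y - y')" using lip by blast
      \<comment> \<open>\<open>lipschitz_on\<close> wants a nonnegative constant, and
        \<open>L\<close> has no given sign.\<close>
      have "norm (g i y - g i y') \<le> \<bar>L\<bar> * norm (y - y')" for y y'
        using L[of y y'] by (meson abs_ge_self mult_right_mono norm_ge_zero order_trans)
      then have "\<bar>L\<bar>-lipschitz_on UNIV (g i)" by (intro lipschitz_onI) (auto simp: dist_norm)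
      then show ?thesis by (rule lipschitz_on_continuous_on)
    qed
    show "argmin_set (\<lambda>z. Max (range (\<lambda>i. f i z - w i))) \<noteq> {}" for w
      using A4 unfolding A4_def by blast
  qed (use conv grad t0 \<alpha> \<beta> q p A3 sol in auto)
  have energy: "\<exists>C. eventually (\<lambda>t. \<bar>energy \<alpha> \<beta> q p f x v r lam t\<bar> \<le> ereal (C * t powr (3*r - (p+1)))) at_top"
    if lam: "0 < lam \<and> lam \<le> 2*\<alpha>/3 \<and> lam \<le> \<beta>/\<alpha>" for lam
  proof -
    interpret mtrigs_lyapunov f \<beta> p g x v acc x0 v0 t0 \<alpha> q r lam
      by unfold_locales (use r lam in auto)
    show ?thesis by (rule energy_rate)
  qed
  \<comment> \<open>The remaining claims do not mention \<open>lam\<close>, so one admissible value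
    serves them all; \<open>\<alpha> / 2\<close> makes the parts of the energy separately
    nonnegative.\<close>
  define lam where "lam = min (\<alpha> / 2) (\<beta> / \<alpha>)"
  interpret mtrigs_lyapunov f \<beta> p g x v acc x0 v0 t0 \<alpha> q r lam
    by unfold_locales (use r \<alpha> \<beta> in \<open>auto simp: lam_def\<close>)
  have "lam \<le> \<alpha> / 2" unfolding lam_def by (rule min.cobounded1)
  note rates = asymptotic_rates[OF this]
  show "(\<forall>lam. 0 < lam \<and> lam \<le> 2*\<alpha>/3 \<and> lam \<le> \<beta>/\<alpha> \<longrightarrow>
        (\<exists>C. eventually (\<lambda>t. \<bar>energy \<alpha> \<beta> q p f x v r lam t\<bar> \<le> ereal (C * t powr (3*r - (p+1)))) at_top))
   \<and> (\<exists>C. eventually (\<lambda>t. \<bar>merit_t \<beta> p f t (x t)\<bar> \<le> ereal (C * t powr (r - (p+1)))) at_top)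
   \<and> (\<exists>C. eventually (\<lambda>t. \<bar>merit f (x t)\<bar> \<le> ereal (C * t powr (-p))) at_top)
   \<and> (\<lambda>t. norm (x t - zpt \<beta> p f t (x t))) \<in> O(\<lambda>t. t powr ((r-1)/2))
   \<and> (\<lambda>t. norm (v t)) \<in> O(\<lambda>t. t powr ((r-(p+1))/2))"
    using energy rates by blast
qed

end
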